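(* Let $m>1$ be real and $R>0$. Then $$\lambda_m(R)=\inf_{v\in H^1((0,R),w_m\,dr)}J_{m,R}(v),$$ where $J_{m,R}:H^1((0,R),w_m\,dr)\to\mathbb R$ is defined by $$J_{m,R}(v)=\mathbb E_{m,R}(v'^2+v^2)+\frac{\mathrm{Var}_{m,R}(Tv)}{m-1}+\frac{(1+\mathbb E_{m,R}Tv)^2}{m}.$$ The minimizer of $J_{m,R}$ exists and is unique; denote it by $v_{m,R}$. There is a unique solution $z=z_{m,R}\in H^1((0,R),w_m\,dr)$, on the regular branch at the origin, of $$-z''+\Bigl(r-\frac mr\Bigr)z'+2z=\frac1r\quad\text{in }(0,R),\qquad mz'(R)=Rz(R)-1.$$ With $H_m(R)=\mathbb E_{m,R}(Tz_{m,R})$ one has $$v_{m,R}=-c_{m,R}\,z_{m,R},\qquad c_{m,R}=\frac{m-1}{m-H_m(R)},\qquad \lambda_m(R)=1-c_{m,R}=\frac{1-H_m(R)}{m-H_m(R)},$$ and the function $g$ attaining the supremum in the definition of $\lambda_m(R)$ is $$g_{m,R}(r)=\frac{m-Tz_{m,R}(r)}{m-H_m(R)}=\frac{m-rz_{m,R}(r)+z_{m,R}'(r)}{m-H_m(R)}.$$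
   Context: For real $m\ge1$ and $R>0$ put $w_m(r)=r^m e^{-r^2/2}$, $W_{m,R}=\int_0^R w_m(r)\,dr$, and let $\mu_{m,R}$ be the probability measure $d\mu_{m,R}(r)=\frac{w_m(r)}{W_{m,R}}\,dr$ on $(0,R)$. Write $\mathbb E_{m,R}\phi=\int_0^R\phi\,d\mu_{m,R}$ and $\mathrm{Var}_{m,R}(\phi)=\mathbb E_{m,R}[(\phi-\mathbb E_{m,R}\phi)^2]$. The space $H^1((0,R),w_m\,dr)$ consists of the real functions $v\in H^1_{\mathrm{loc}}((0,R))$ with $\int_0^R(v^2+v'^2)w_m\,dr<\infty$. For such $v$ set $(Tv)(r)=rv(r)-v'(r)$. For $g\in L^2((0,R),w_m\,dr)$ with $\mathbb E_{m,R}g=1$ and $v\in H^1((0,R),w_m\,dr)$ define $$\Phi_{m,R}(g,v)=\mathbb E_{m,R}\Big[v'^2+v^2+\frac{(g+Tv)^2}{m}\Big]-\mathrm{Var}_{m,R}(g),\qquad \lambda_m(R)=\sup_{\substack{g\in L^2((0,R),w_m\,dr)\\ \mathbb E_{m,R}g=1}}\ \inf_{v\in H^1((0,R),w_m\,dr)}\Phi_{m,R}(g,v).$$ "On the regular branch at the origin" means exactly the branch selected by finite energy, i.e. by membership in $H^1((0,R),w_m\,dr)$; this excludes the homogeneous solutions behaving like $r^{1-m}$ at $0$ and is not an additional boundary condition. *)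

theory Defs
  imports "HOL-Analysis.Analysis"
begin

text \<open>
  Weak derivatives on an open set \<open>S\<close> of reals are tested against \<open>C\<^sup>1\<close> functions
  with compact support in \<open>S\<close> (Brezis' convention; testing against smooth functions
  only gives the same notion).  A test function is extended by zero to the whole line.
\<close>

definition test_function :: "real set \<Rightarrow> (real \<Rightarrow> real) \<Rightarrow> (real \<Rightarrow> real) \<Rightarrow> bool" where
  "test_function S \<phi> \<phi>' \<longleftrightarrow>
     (\<forall>x. (\<phi> has_real_derivative \<phi>' x) (at x)) \<and> continuous_on UNIV \<phi>' \<and>
     (\<exists>K. compact K \<and> K \<subseteq> S \<and> (\<forall>x. x \<notin> K \<longrightarrow> \<phi> x = 0))"

definition locally_integrable :: "real set \<Rightarrow> (real \<Rightarrow> real) \<Rightarrow> bool" where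
  "locally_integrable S f \<longleftrightarrow>
     (\<forall>K. compact K \<and> K \<subseteq> S \<longrightarrow> integrable (lebesgue_on K) f)"

definition locally_square_integrable :: "real set \<Rightarrow> (real \<Rightarrow> real) \<Rightarrow> bool" where
  "locally_square_integrable S f \<longleftrightarrow>
     f \<in> borel_measurable (lebesgue_on S) \<and>
     (\<forall>K. compact K \<and> K \<subseteq> S \<longrightarrow> integrable (lebesgue_on K) (\<lambda>x. (f x)\<^sup>2))"

definition has_weak_deriv :: "real set \<Rightarrow> (real \<Rightarrow> real) \<Rightarrow> (real \<Rightarrow> real) \<Rightarrow> bool" where
  "has_weak_deriv S f d \<longleftrightarrow>
     locally_integrable S f \<and> locally_integrable S d \<and>
     (\<forall>\<phi> \<phi>'. test_function S \<phi> \<phi>' \<longrightarrow>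
        (\<integral>x. f x * \<phi>' x \<partial>lebesgue_on S) = - (\<integral>x. d x * \<phi> x \<partial>lebesgue_on S))"

text \<open>
  The weak derivative is determined only almost everywhere; \<open>weak_deriv\<close> picks a
  representative.  Elements of the function spaces below are likewise actual functions,
  identified when they agree almost everywhere; values outside the interval are irrelevant.
\<close>

definition weak_deriv :: "real set \<Rightarrow> (real \<Rightarrow> real) \<Rightarrow> real \<Rightarrow> real" where
  "weak_deriv S f = (SOME d. has_weak_deriv S f d)"

definition H1_loc :: "real set \<Rightarrow> (real \<Rightarrow> real) set" where
  "H1_loc S = {v. locally_square_integrable S v \<and>
                  (\<exists>d. has_weak_deriv S v d \<and> locally_square_integrable S d)}"

definition wgt :: "real \<Rightarrow> real \<Rightarrow> real" where
  "wgt m r = r powr m * exp (- r\<^sup>2 / 2)"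

definition Wgt :: "real \<Rightarrow> real \<Rightarrow> real" where
  "Wgt m R = (\<integral>r. wgt m r \<partial>lebesgue_on {0<..<R})"

definition mu :: "real \<Rightarrow> real \<Rightarrow> real measure" where
  "mu m R = density (lebesgue_on {0<..<R}) (\<lambda>r. ennreal (wgt m r / Wgt m R))"

definition Ex :: "real \<Rightarrow> real \<Rightarrow> (real \<Rightarrow> real) \<Rightarrow> real" where
  "Ex m R \<phi> = (\<integral>r. \<phi> r \<partial>mu m R)"

definition Var :: "real \<Rightarrow> real \<Rightarrow> (real \<Rightarrow> real) \<Rightarrow> real" where
  "Var m R \<phi> = Ex m R (\<lambda>r. (\<phi> r - Ex m R \<phi>)\<^sup>2)"

definition L2w :: "real \<Rightarrow> real \<Rightarrow> (real \<Rightarrow> real) set" where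
  "L2w m R = {g \<in> borel_measurable (lebesgue_on {0<..<R}).
                integrable (lebesgue_on {0<..<R}) (\<lambda>r. (g r)\<^sup>2 * wgt m r)}"

abbreviation wd :: "real \<Rightarrow> (real \<Rightarrow> real) \<Rightarrow> real \<Rightarrow> real" where
  "wd R \<equiv> weak_deriv {0<..<R}"

definition H1w :: "real \<Rightarrow> real \<Rightarrow> (real \<Rightarrow> real) set" where
  "H1w m R = {v \<in> H1_loc {0<..<R}.
                integrable (lebesgue_on {0<..<R}) (\<lambda>r. ((v r)\<^sup>2 + (wd R v r)\<^sup>2) * wgt m r)}"

definition T :: "real \<Rightarrow> (real \<Rightarrow> real) \<Rightarrow> real \<Rightarrow> real" where
  "T R v r = r * v r - wd R v r"

definition Phi :: "real \<Rightarrow> real \<Rightarrow> (real \<Rightarrow> real) \<Rightarrow> (real \<Rightarrow> real) \<Rightarrow> real" where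
  "Phi m R g v =
     Ex m R (\<lambda>r. (wd R v r)\<^sup>2 + (v r)\<^sup>2 + (g r + T R v r)\<^sup>2 / m) - Var m R g"

text \<open>Suprema and infima are taken in the extended reals, so that they always exist.\<close>

definition inner_inf :: "real \<Rightarrow> real \<Rightarrow> (real \<Rightarrow> real) \<Rightarrow> ereal" where
  "inner_inf m R g = (INF v\<in>H1w m R. ereal (Phi m R g v))"

definition lambda :: "real \<Rightarrow> real \<Rightarrow> ereal" where
  "lambda m R = (SUP g\<in>{g \<in> L2w m R. Ex m R g = 1}. inner_inf m R g)"

definition attains_sup :: "real \<Rightarrow> real \<Rightarrow> (real \<Rightarrow> real) \<Rightarrow> bool" where
  "attains_sup m R g \<longleftrightarrow> g \<in> L2w m R \<and> Ex m R g = 1 \<and> inner_inf m R g = lambda m R"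

definition J :: "real \<Rightarrow> real \<Rightarrow> (real \<Rightarrow> real) \<Rightarrow> real" where
  "J m R v = Ex m R (\<lambda>r. (wd R v r)\<^sup>2 + (v r)\<^sup>2)
             + Var m R (T R v) / (m - 1) + (1 + Ex m R (T R v))\<^sup>2 / m"

definition is_minimizer :: "real \<Rightarrow> real \<Rightarrow> (real \<Rightarrow> real) \<Rightarrow> bool" where
  "is_minimizer m R v \<longleftrightarrow> v \<in> H1w m R \<and> (\<forall>u\<in>H1w m R. J m R v \<le> J m R u)"

text \<open>
  Solutions are classical: \<open>C\<^sup>1\<close> on \<open>(0,R]\<close> (one-sided at \<open>R\<close>) and twice differentiable
  inside.  The regular branch at the origin is selected solely by membership in \<open>H1w m R\<close>.
\<close>

definition bvp_solution :: "real \<Rightarrow> real \<Rightarrow> (real \<Rightarrow> real) \<Rightarrow> bool" where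
  "bvp_solution m R z \<longleftrightarrow> z \<in> H1w m R \<and>
     (\<exists>z' z''.
        (\<forall>r\<in>{0<..R}. (z has_real_derivative z' r) (at r within {0<..R})) \<and>
        continuous_on {0<..R} z' \<and>
        (\<forall>r\<in>{0<..<R}. (z' has_real_derivative z'' r) (at r)) \<and>
        (\<forall>r\<in>{0<..<R}. - z'' r + (r - m / r) * z' r + 2 * z r = 1 / r) \<and>
        m * z' R = R * z R - 1)"

definition Hm :: "real \<Rightarrow> real \<Rightarrow> (real \<Rightarrow> real) \<Rightarrow> real" where
  "Hm m R z = Ex m R (T R z)"

definition cm :: "real \<Rightarrow> real \<Rightarrow> (real \<Rightarrow> real) \<Rightarrow> real" where
  "cm m R z = (m - 1) / (m - Hm m R z)"

end

theory Submission
  imports Defs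
begin

text \<open>
  The theorem is a saddle point argument.  Let \<open>E\<close> denote expectation under the probability measure
  with density proportional to the weight \<open>w\<close>, let \<open>z\<close> solve the boundary value problem, and put
  \<open>H = E (T z)\<close> and \<open>c = (m - 1) / (m - H)\<close>.  Completing the square in \<open>g\<close> gives, for \<open>E g = 1\<close>,
  \<open>J v - \<Phi>(g, v) = (m - 1) / m * E (g - 1 - (T v - E (T v)) / (m - 1))\<^sup>2\<close>
  (lemma \<open>J_minus_Phi\<close>), so \<open>J v\<close> is the maximum of \<open>\<Phi>(g, v)\<close> over \<open>g\<close>.  Completing the square in
  \<open>v\<close> at \<open>g = g_opt = (m - T z) / (m - H)\<close> gives
  \<open>\<Phi>(g_opt, v) = 1 - c + E (v' + c z')\<^sup>2 + E (v + c z)\<^sup>2 + E (T v + c T z)\<^sup>2 / m\<close>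
  (lemma \<open>Phi_g_opt\<close>).  Hence \<open>(g_opt, - c z)\<close> is a saddle point with value \<open>1 - c\<close>: this yields the
  value of the supremum and of the infimum of \<open>J\<close>, and the squares yield uniqueness of both optimizers.

  The second identity rests on the weak form of the boundary value problem (lemma
  \<open>regular_solution_weak_form\<close>),
  \<open>E (z' v') + E (z v) + E (T z * T v) / (m - 1) = E (T v) / (m - 1)\<close>
  for every \<open>v\<close> in the weighted Sobolev space.  With \<open>q = z' - (T z - 1) / (m - 1)\<close> the differential
  equation reads \<open>(w q)' = w (z + r (T z - 1) / (m - 1))\<close>, and the condition at \<open>R\<close> reads
  \<open>q R = 0\<close>.  At the origin \<open>w q\<close> tends to \<open>0\<close> because the energy is finite (lemma \<open>wgt_L2w_limit_eq_0\<close>).  Integrating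
  \<open>(w q v)'\<close> therefore leaves no boundary terms, which for a merely weakly differentiable \<open>v\<close> is
  lemma \<open>weak_deriv_by_parts\<close>.  Taking \<open>v = z\<close> in the weak form also gives
  \<open>H\<^sup>2 \<le> E (T z)\<^sup>2 \<le> H\<close>, so \<open>H \<le> 1 < m\<close>, and taking \<open>v = z\<close> in the homogeneous version gives
  uniqueness for the boundary value problem.

  For existence, the equation integrates once to \<open>r z' + (m - 1 - r\<^sup>2) z = C - r\<close>, so the
  finite-energy solutions form an explicit one-parameter family.  The condition at \<open>R\<close> is affine
  in \<open>C\<close>, and its slope is nonzero by homogeneous uniqueness.
\<close>

section \<open>Test functions on an interval\<close>

lemma has_real_derivative_max_0_square:
  "((\<lambda>t::real. (max 0 t)\<^sup>2) has_real_derivative 2 * max 0 x) (at x)"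
proof (cases x "0::real" rule: linorder_cases)
  case less
  have "((\<lambda>t::real. 0) has_real_derivative 2 * max 0 x) (at x)"
    using less by simp
  then show ?thesis
    by (rule has_field_derivative_transform_within_open[where S="{..<0}"]) (use less in auto)
next
  case greater
  have "((\<lambda>t::real. t\<^sup>2) has_real_derivative 2 * max 0 x) (at x)"
    using greater by (auto intro!: derivative_eq_intros)
  then show ?thesis
    by (rule has_field_derivative_transform_within_open[where S="{0<..}"]) (use greater in auto)
next
  case equal
  have "((\<lambda>y. ((max 0 y)\<^sup>2 - (max 0 0)\<^sup>2) / (y - 0)) \<longlongrightarrow> (0::real)) (at 0)"
  proof (rule Lim_null_comparison)
    show "\<forall>\<^sub>F y in at (0::real). norm (((max 0 y)\<^sup>2 - (max 0 0)\<^sup>2) / (y - 0)) \<le> \<bar>y\<bar>"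
      by (intro always_eventually allI) (auto simp: max_def power2_eq_square)
    show "((\<lambda>y. \<bar>y\<bar>) \<longlongrightarrow> (0::real)) (at 0)"
      by (intro tendsto_eq_intros) auto
  qed
  then show ?thesis
    using equal by (simp add: has_field_derivative_iff)
qed

lemma integrable_lebesgue_on_subset:
  fixes f :: "real \<Rightarrow> real"
  assumes "integrable (lebesgue_on U) f" "S \<subseteq> U" "S \<in> sets lebesgue" "U \<in> sets lebesgue"
  shows "integrable (lebesgue_on S) f"
proof -
  have "set_integrable lebesgue U f"
    using assms by (simp add: set_integrable_def integrable_restrict_space)
  then have "set_integrable lebesgue S f"
    by (rule set_integrable_subset) (use assms in auto)
  then show ?thesis
    using assms by (simp add: set_integrable_def integrable_restrict_space)
qed

lemma test_function_measurable:
  assumes "test_function S \<phi> \<phi>'"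
  shows "\<phi> \<in> borel_measurable (lebesgue_on U)" "\<phi>' \<in> borel_measurable (lebesgue_on U)"
proof -
  have "continuous_on UNIV \<phi>"
    using assms unfolding test_function_def by (meson DERIV_atLeastAtMost_imp_continuous_on DERIV_continuous_on has_field_derivative_at_within)
  moreover have "continuous_on UNIV \<phi>'"
    using assms by (auto simp: test_function_def)
  ultimately have "\<phi> \<in> borel_measurable borel" "\<phi>' \<in> borel_measurable borel"
    by (auto intro: borel_measurable_continuous_onI)
  then show "\<phi> \<in> borel_measurable (lebesgue_on U)" "\<phi>' \<in> borel_measurable (lebesgue_on U)"
    by (auto intro!: measurable_restrict_space1 measurable_completion)
qed

lemma test_function_deriv_eq_0:
  assumes tf: "test_function S \<phi> \<phi>'" and K: "closed K" "\<And>x. x \<notin> K \<Longrightarrow> \<phi> x = 0" and x: "x \<notin> K"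
  shows "\<phi>' x = 0"
proof -
  have "(\<phi> has_real_derivative 0) (at x)"
    by (rule has_field_derivative_transform_within_open[of "\<lambda>_. 0" 0 _ "- K"]) (use K x in auto)
  moreover have "(\<phi> has_real_derivative \<phi>' x) (at x)"
    using tf by (auto simp: test_function_def)
  ultimately show ?thesis by (metis DERIV_unique)
qed

text \<open>Extension by zero: the derivative survives because near a point outside \<open>S\<close> only
  points outside the compact set \<open>K\<close> are seen.\<close>

lemma test_function_extend_0:
  fixes f f' :: "real \<Rightarrow> real"
  assumes S: "open S" and K: "compact K" "K \<subseteq> S"
    and der: "\<And>x. x \<in> S \<Longrightarrow> (f has_real_derivative f' x) (at x)"
    and cont: "continuous_on S f'"
    and zero: "\<And>x. x \<in> S \<Longrightarrow> x \<notin> K \<Longrightarrow> f x = 0"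
  shows "test_function S (\<lambda>x. if x \<in> S then f x else 0) (\<lambda>x. if x \<in> S then f' x else 0)"
proof -
  let ?f = "\<lambda>x. if x \<in> S then f x else 0" and ?g = "\<lambda>x. if x \<in> S then f' x else 0"
  have oK: "open (- K)" using K(1) by (simp add: compact_imp_closed open_Compl)
  have D: "(?f has_real_derivative ?g x) (at x)" for x
  proof (cases "x \<in> S")
    case True
    have "(?f has_real_derivative f' x) (at x)"
      by (rule has_field_derivative_transform_within_open[OF der[OF True] S True]) auto
    then show ?thesis using True by simp
  next
    case False
    have "(?f has_real_derivative 0) (at x)"
      by (rule has_field_derivative_transform_within_open[of "\<lambda>_. 0" 0 _ "- K"]) (use oK K False zero in auto)
    then show ?thesis using False by simp
  qed
  have g0: "?g x = 0" if "x \<in> - K" for x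
  proof -
    have "(?f has_real_derivative 0) (at x)"
      by (rule has_field_derivative_transform_within_open[of "\<lambda>_. 0" 0 _ "- K"]) (use oK that zero in auto)
    then show ?thesis using D[of x] DERIV_unique by blast
  qed
  have "continuous_on (S \<union> - K) ?g"
  proof (rule continuous_on_open_Un[OF S oK])
    show "continuous_on S ?g"
      using cont by (rule continuous_on_eq) auto
    show "continuous_on (- K) ?g"
      by (rule continuous_on_eq[OF continuous_on_const[of _ 0]]) (use g0 in auto)
  qed
  moreover have "S \<union> - K = UNIV" using K by auto
  ultimately have "continuous_on UNIV ?g" by metis
  then show ?thesis
    unfolding test_function_def using D K zero by (intro conjI exI[of _ K]) auto
qed

text \<open>A test function vanishes at both ends of the interval, so the fundamental theorem of calculus
  gives no boundary term.\<close>

lemma integral_test_function_deriv: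
  fixes A B :: real
  assumes AB: "A < B" and tf: "test_function {A<..<B} \<phi> \<phi>'"
  shows "integrable (lebesgue_on {A<..<B}) \<phi>'" "(\<integral>x. \<phi>' x \<partial>lebesgue_on {A<..<B}) = 0"
proof -
  have D: "\<And>x. (\<phi> has_real_derivative \<phi>' x) (at x)" and C: "continuous_on UNIV \<phi>'"
    using tf by (auto simp: test_function_def)
  have "integrable (lebesgue_on {A..B}) \<phi>'"
    using C by (intro continuous_imp_integrable_real continuous_on_subset[OF C]) auto
  then show i: "integrable (lebesgue_on {A<..<B}) \<phi>'"
    by (rule integrable_lebesgue_on_subset) auto
  have "(\<phi>' has_integral (\<phi> B - \<phi> A)) {A..B}"
    using AB D by (intro fundamental_theorem_of_calculus)
      (auto simp: has_real_derivative_iff_has_vector_derivative[symmetric] intro: has_field_derivative_at_within)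
  moreover have "\<phi> A = 0" "\<phi> B = 0"
    using tf by (auto simp: test_function_def)
  ultimately have "(\<phi>' has_integral 0) {A<..<B}"
    by (simp add: has_integral_Icc_iff_Ioo)
  then show "(\<integral>x. \<phi>' x \<partial>lebesgue_on {A<..<B}) = 0"
    using lebesgue_integral_eq_integral[OF i] by (simp add: integral_unique)
qed

lemma locally_integrable_times_test_function:
  assumes w: "locally_integrable S d" and tf: "test_function S \<phi> \<phi>'" and S: "S \<in> sets lebesgue"
  shows "integrable (lebesgue_on S) (\<lambda>x. d x * \<phi> x)" "integrable (lebesgue_on S) (\<lambda>x. d x * \<phi>' x)"
proof -
  obtain K where K: "compact K" "K \<subseteq> S" "\<And>x. x \<notin> K \<Longrightarrow> \<phi> x = 0"
    and D: "\<And>x. (\<phi> has_real_derivative \<phi>' x) (at x)" and C: "continuous_on UNIV \<phi>'"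
    using tf by (auto simp: test_function_def)
  have c\<phi>: "continuous_on UNIV \<phi>"
    by (rule DERIV_continuous_on[OF has_field_derivative_at_within[OF D]])
  have z': "\<phi>' x = 0" if "x \<notin> K" for x
    by (rule test_function_deriv_eq_0[OF tf _ K(3) that]) (use K in \<open>auto simp: compact_imp_closed\<close>)
  have K_leb: "K \<in> sets lebesgue" using K by (auto intro: lmeasurable_compact fmeasurableD)
  have dK: "integrable (lebesgue_on K) d"
    using w K by (auto simp: locally_integrable_def)
  have int: "integrable (lebesgue_on S) (\<lambda>x. d x * h x)"
    if h: "continuous_on UNIV h" "\<And>x. x \<notin> K \<Longrightarrow> h x = 0" for h :: "real \<Rightarrow> real"
  proof -
    have hK: "continuous_on K h" using h(1) continuous_on_subset by blast
    obtain C where C: "\<And>x. x \<in> K \<Longrightarrow> norm (h x) \<le> C"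
      using compact_imp_bounded[OF compact_continuous_image[OF hK K(1)]] by (auto simp: bounded_iff)
    have "integrable (lebesgue_on K) (\<lambda>x. d x * h x)"
    proof (rule Bochner_Integration.integrable_bound)
      show "integrable (lebesgue_on K) (\<lambda>x. C * d x)" using dK by simp
      show "(\<lambda>x. d x * h x) \<in> borel_measurable (lebesgue_on K)"
        by (intro borel_measurable_times borel_measurable_integrable[OF dK]
            continuous_imp_measurable_on_sets_lebesgue hK K_leb)
      show "AE x in lebesgue_on K. norm (d x * h x) \<le> norm (C * d x)"
      proof (rule AE_I2)
        fix x assume "x \<in> space (lebesgue_on K)"
        then have "\<bar>h x\<bar> \<le> \<bar>C\<bar>" using C[of x] by auto
        then show "norm (d x * h x) \<le> norm (C * d x)"
          using mult_right_mono[of "\<bar>h x\<bar>" "\<bar>C\<bar>" "\<bar>d x\<bar>"] by (simp add: abs_mult mult.commute)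
      qed
    qed
    then have "integrable lebesgue (\<lambda>x. if x \<in> K then d x * h x else 0)"
      using K_leb Lebesgue_Measure.integrable_restrict_UNIV[of K "\<lambda>x. d x * h x"] by auto
    moreover have "(\<lambda>x. if x \<in> K then d x * h x else 0) = (\<lambda>x. if x \<in> S then d x * h x else 0)"
      using h K by (auto simp: fun_eq_iff)
    ultimately show ?thesis
      using S Lebesgue_Measure.integrable_restrict_UNIV[of S "\<lambda>x. d x * h x"] by auto
  qed
  show "integrable (lebesgue_on S) (\<lambda>x. d x * \<phi> x)" "integrable (lebesgue_on S) (\<lambda>x. d x * \<phi>' x)"
    using int[OF c\<phi> K(3)] int[OF C z'] by auto
qed

section \<open>Weak derivatives on an interval\<close>

lemma continuous_imp_locally_integrable:
  assumes "continuous_on S f"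
  shows "locally_integrable S f"
  unfolding locally_integrable_def
proof safe
  fix K assume K: "compact K" "K \<subseteq> S"
  have cK: "continuous_on K f" using assms K continuous_on_subset by blast
  obtain C where "\<And>x. x \<in> K \<Longrightarrow> norm (f x) \<le> C"
    using compact_imp_bounded[OF compact_continuous_image[OF cK K(1)]] by (auto simp: bounded_iff)
  moreover have "f \<in> borel_measurable (lebesgue_on K)"
    by (rule continuous_imp_measurable_on_sets_lebesgue[OF cK])
      (use K in \<open>auto intro: lmeasurable_compact fmeasurableD\<close>)
  moreover have "finite_measure (lebesgue_on K)"
    using K by (intro finite_measure_lebesgue_on lmeasurable_compact)
  ultimately show "integrable (lebesgue_on K) f"
    by (intro finite_measure.integrable_const_bound[of _ _ C]) auto
qed

text \<open>The product of \<open>f\<close> with a test function is, extended by zero, again a test function, and its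
  derivative integrates to zero.\<close>

lemma classical_imp_weak_deriv:
  fixes A B :: real
  assumes AB: "A < B"
    and der: "\<And>x. x \<in> {A<..<B} \<Longrightarrow> (f has_real_derivative f' x) (at x)"
    and cont: "continuous_on {A<..<B} f'"
  shows "has_weak_deriv {A<..<B} f f'"
  unfolding has_weak_deriv_def
proof (intro conjI allI impI)
  let ?S = "{A<..<B}"
  have cf: "continuous_on ?S f"
    by (rule DERIV_continuous_on[OF has_field_derivative_at_within[OF der]])
  show "locally_integrable ?S f" "locally_integrable ?S f'"
    using cf cont by (auto intro: continuous_imp_locally_integrable)
  fix \<phi> \<phi>' assume tf: "test_function ?S \<phi> \<phi>'"
  then obtain K where K: "compact K" "K \<subseteq> ?S" "\<And>x. x \<notin> K \<Longrightarrow> \<phi> x = 0"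
    and D: "\<And>x. (\<phi> has_real_derivative \<phi>' x) (at x)" and C: "continuous_on UNIV \<phi>'"
    by (auto simp: test_function_def)
  have c\<phi>: "continuous_on UNIV \<phi>"
    by (rule DERIV_continuous_on[OF has_field_derivative_at_within[OF D]])
  have c1: "continuous_on ?S (\<lambda>x. f x * \<phi>' x)" and c2: "continuous_on ?S (\<lambda>x. f' x * \<phi> x)"
    by (intro continuous_intros cf cont continuous_on_subset[OF C] continuous_on_subset[OF c\<phi>]; simp)+
  have i1: "integrable (lebesgue_on ?S) (\<lambda>x. f x * \<phi>' x)"
    and i2: "integrable (lebesgue_on ?S) (\<lambda>x. f' x * \<phi> x)"
    using continuous_imp_locally_integrable[OF cf] continuous_imp_locally_integrable[OF cont] tf
    by (auto intro: locally_integrable_times_test_function)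
  have "test_function ?S (\<lambda>x. if x \<in> ?S then f x * \<phi> x else 0) (\<lambda>x. if x \<in> ?S then f x * \<phi>' x + f' x * \<phi> x else 0)"
  proof (rule test_function_extend_0[OF _ K(1,2)])
    show "((\<lambda>x. f x * \<phi> x) has_real_derivative f x * \<phi>' x + f' x * \<phi> x) (at x)" if "x \<in> ?S" for x
      using DERIV_mult[OF der[OF that] D[of x]] by (simp add: algebra_simps)
    show "continuous_on ?S (\<lambda>x. f x * \<phi>' x + f' x * \<phi> x)"
      by (intro continuous_on_add c1 c2)
  qed (use K in auto)
  from integral_test_function_deriv(2)[OF AB this]
  have "(\<integral>x. (if x \<in> ?S then f x * \<phi>' x + f' x * \<phi> x else 0) \<partial>lebesgue_on ?S) = 0" .
  also have "(\<integral>x. (if x \<in> ?S then f x * \<phi>' x + f' x * \<phi> x else 0) \<partial>lebesgue_on ?S)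
      = (\<integral>x. f x * \<phi>' x + f' x * \<phi> x \<partial>lebesgue_on ?S)"
    by (rule Bochner_Integration.integral_cong) auto
  also have "\<dots> = (\<integral>x. f x * \<phi>' x \<partial>lebesgue_on ?S) + (\<integral>x. f' x * \<phi> x \<partial>lebesgue_on ?S)"
    by (rule Bochner_Integration.integral_add[OF i1 i2])
  finally show "(\<integral>x. f x * \<phi>' x \<partial>lebesgue_on ?S) = - (\<integral>x. f' x * \<phi> x \<partial>lebesgue_on ?S)"
    by simp
qed

text \<open>With \<open>0 \<le> u \<le> 1\<close> a bump that is positive exactly on \<open>(c, d)\<close>, the functions \<open>1 - (1 - u)\<^sup>n\<close>
  increase to the indicator of that interval, so orthogonality to test functions yields
  orthogonality to indicators of intervals.\<close>

lemma integral_Icc_eq_0_if_orthogonal: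
  assumes loc: "locally_integrable {A<..<B} e"
    and orth: "\<And>\<phi> \<phi>'. test_function {A<..<B} \<phi> \<phi>' \<Longrightarrow> (\<integral>x. e x * \<phi> x \<partial>lebesgue_on {A<..<B}) = 0"
    and cd: "A < c" "c < d" "d < B"
  shows "integral {c..d} e = 0"
proof -
  let ?L = "lebesgue_on {c..d}" and ?S = "{A<..<B}"
  have "{c..d} \<subseteq> ?S" using cd by auto
  then have ei: "integrable ?L e"
    using loc by (simp add: locally_integrable_def)
  define q where "q x = (x - c) * (d - x)" for x
  define u where "u x = (max 0 (q x))\<^sup>2 / (d - c)^4" for x
  define u' where "u' x = 2 * max 0 (q x) * (c + d - 2 * x) / (d - c)^4" for x
  have du: "(u has_real_derivative u' x) (at x)" for x
  proof -
    have "(q has_real_derivative c + d - 2 * x) (at x)"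
      unfolding q_def by (auto intro!: derivative_eq_intros)
    then have "((\<lambda>x. (max 0 (q x))\<^sup>2) has_real_derivative 2 * max 0 (q x) * (c + d - 2 * x)) (at x)"
      by (rule DERIV_chain2[OF has_real_derivative_max_0_square])
    then show ?thesis unfolding u_def u'_def by (rule DERIV_cdivide)
  qed
  have q_le: "q x \<le> (d - c)\<^sup>2" if "x \<in> {c..d}" for x
    unfolding q_def power2_eq_square using that by (intro mult_mono) auto
  have u01: "0 \<le> u x" "u x \<le> 1" for x
  proof -
    show "0 \<le> u x" by (simp add: u_def)
    have "q x \<le> (d - c)\<^sup>2"
    proof (cases "x \<in> {c..d}")
      case False
      then have "q x \<le> 0"
        using cd by (auto simp: q_def mult_le_0_iff)
      then show ?thesis by (smt (verit) zero_le_power2)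
    qed (rule q_le)
    then have "(max 0 (q x))\<^sup>2 \<le> ((d - c)\<^sup>2)\<^sup>2"
      by (intro power_mono) auto
    then show "u x \<le> 1"
      using cd by (simp add: u_def divide_le_eq)
  qed
  have u_pos: "0 < u x" if "x \<in> {c<..<d}" for x
    using that cd by (simp add: u_def q_def)
  have u_0: "u x = 0" if "x \<notin> {c<..<d}" for x
  proof -
    have "q x \<le> 0" using that cd by (auto simp: q_def mult_le_0_iff)
    then show ?thesis by (simp add: u_def)
  qed
  define p where "p n x = 1 - (1 - u x)^n" for n :: nat and x
  have cu': "continuous_on UNIV u'"
    unfolding u'_def q_def using cd by (intro continuous_intros) auto
  have cu: "continuous_on UNIV u"
    by (rule DERIV_continuous_on[OF has_field_derivative_at_within[OF du]])
  have tf: "test_function ?S (p n) (\<lambda>x. real n * (1 - u x)^(n - 1) * u' x)" for n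
    unfolding test_function_def
  proof (intro conjI allI exI)
    show "(p n has_real_derivative real n * (1 - u x)^(n - 1) * u' x) (at x)" for x
      unfolding p_def by (rule derivative_eq_intros du refl | simp)+
    show "continuous_on UNIV (\<lambda>x. real n * (1 - u x)^(n - 1) * u' x)"
      by (intro continuous_intros cu cu')
    show "compact {c..d}" "{c..d} \<subseteq> ?S" using cd by auto
    show "x \<notin> {c..d} \<longrightarrow> p n x = 0" for x
      using u_0[of x] by (auto simp: p_def)
  qed
  have zero: "(\<integral>x. e x * p n x \<partial>?L) = 0" for n
  proof -
    have "(\<integral>x. e x * p n x \<partial>?L) = (\<integral>x. (if x \<in> {c..d} then e x * p n x else 0) \<partial>lebesgue_on ?S)"
      by (rule integral_restrict[symmetric]) (use cd in auto)
    also have "\<dots> = (\<integral>x. e x * p n x \<partial>lebesgue_on ?S)"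
      by (rule Bochner_Integration.integral_cong) (use u_0 in \<open>auto simp: p_def\<close>)
    finally show ?thesis using orth[OF tf] by simp
  qed
  have "(\<lambda>n. \<integral>x. e x * p n x \<partial>?L) \<longlonglongrightarrow> (\<integral>x. e x * (if x \<in> {c<..<d} then 1 else 0) \<partial>?L)"
  proof (rule integral_dominated_convergence)
    show "integrable ?L (\<lambda>x. \<bar>e x\<bar>)" using ei by simp
    show "(\<lambda>x. e x * p n x) \<in> borel_measurable ?L" for n
      by (intro borel_measurable_times borel_measurable_integrable[OF ei] test_function_measurable(1)[OF tf])
    show "(\<lambda>x. e x * (if x \<in> {c<..<d} then 1 else 0)) \<in> borel_measurable ?L"
      by (intro borel_measurable_times borel_measurable_integrable[OF ei] measurable_restrict_space1
          measurable_completion) auto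
    show "AE x in ?L. norm (e x * p n x) \<le> \<bar>e x\<bar>" for n
    proof (rule AE_I2)
      fix x
      have "0 \<le> (1 - u x)^n" "(1 - u x)^n \<le> 1"
        using u01[of x] by (auto intro: power_le_one)
      then have "\<bar>p n x\<bar> \<le> 1" unfolding p_def by auto
      then show "norm (e x * p n x) \<le> \<bar>e x\<bar>"
        by (simp add: abs_mult mult_left_le)
    qed
    show "AE x in ?L. (\<lambda>n. e x * p n x) \<longlonglongrightarrow> e x * (if x \<in> {c<..<d} then 1 else 0)"
    proof (rule AE_I2)
      fix x
      show "(\<lambda>n. e x * p n x) \<longlonglongrightarrow> e x * (if x \<in> {c<..<d} then 1 else 0)"
      proof (cases "x \<in> {c<..<d}")
        case True
        have "(\<lambda>n. (1 - u x)^n) \<longlonglongrightarrow> 0"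
          by (rule LIMSEQ_realpow_zero) (use u01[of x] u_pos[OF True] in auto)
        then have "(\<lambda>n. e x * p n x) \<longlonglongrightarrow> e x * (1 - 0)"
          unfolding p_def by (intro tendsto_mult tendsto_diff tendsto_const)
        then show ?thesis using True by simp
      next
        case False
        then show ?thesis using u_0[OF False] by (auto simp: p_def)
      qed
    qed
  qed
  then have "(\<integral>x. e x * (if x \<in> {c<..<d} then 1 else 0) \<partial>?L) = 0"
    by (simp add: zero LIMSEQ_const_iff)
  also have "(\<integral>x. e x * (if x \<in> {c<..<d} then 1 else 0) \<partial>?L)
      = (\<integral>x. (if x \<in> {c<..<d} then e x else 0) \<partial>?L)"
    by (rule Bochner_Integration.integral_cong) auto
  also have "\<dots> = (\<integral>x. e x \<partial>lebesgue_on {c<..<d})"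
    by (rule integral_restrict) auto
  also have "\<dots> = integral {c<..<d} e"
    by (rule lebesgue_integral_eq_integral)
      (auto intro: integrable_lebesgue_on_subset[OF ei])
  finally show ?thesis by (simp add: integral_open_interval_real)
qed

text \<open>The averages of \<open>e\<close> over all short intervals vanish, and almost everywhere they converge to
  \<open>e\<close> by Lebesgue differentiation.  The interval is exhausted by compact ones because \<open>e\<close> is
  integrable only locally.\<close>

lemma AE_eq_0_if_orthogonal:
  assumes AB: "A < B"
    and loc: "locally_integrable {A<..<B} e"
    and orth: "\<And>\<phi> \<phi>'. test_function {A<..<B} \<phi> \<phi>' \<Longrightarrow> (\<integral>x. e x * \<phi> x \<partial>lebesgue_on {A<..<B}) = 0"
  shows "AE x in lebesgue_on {A<..<B}. e x = 0"
proof -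
  have ex: "\<exists>N. negligible N \<and> (\<forall>x. a < x \<and> x < b \<and> x \<notin> N \<longrightarrow> e x = 0)"
    if ab: "A < a" "b < B" for a b
  proof -
    define f where "f = (\<lambda>x. if x \<in> {a..b} then e x else 0)"
    have "{a..b} \<subseteq> {A<..<B}" using ab by auto
    then have "integrable (lebesgue_on {a..b}) e"
      using loc by (simp add: locally_integrable_def)
    then have "e integrable_on {a..b}"
      by (rule integrable_on_lebesgue_on) auto
    then have "f integrable_on UNIV"
      unfolding f_def using integrable_restrict_UNIV by blast
    then have "f integrable_on cbox x y" for x y
      by (rule integrable_on_subcbox) auto
    then obtain N where N: "negligible N"
      "\<And>x e. \<lbrakk>x \<notin> N; 0 < e\<rbrakk> \<Longrightarrow>
         \<exists>d>0. \<forall>h. 0 < h \<and> h < d \<longrightarrow>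
           norm (integral (cbox x (x + h *\<^sub>R One)) f /\<^sub>R h ^ DIM(real) - f x) < e"
      by (rule integrable_ccontinuous_explicit) blast
    have "e x = 0" if x: "a < x" "x < b" "x \<notin> N" for x
    proof (rule ccontr)
      assume "e x \<noteq> 0"
      then have "0 < \<bar>f x\<bar>" using x by (simp add: f_def)
      from N(2)[OF x(3) this] obtain d where d: "d > 0"
        "\<And>h. 0 < h \<Longrightarrow> h < d \<Longrightarrow> norm (integral (cbox x (x + h *\<^sub>R One)) f /\<^sub>R h ^ DIM(real) - f x) < \<bar>f x\<bar>"
        by blast
      define h where "h = min (d / 2) ((b - x) / 2)"
      have h: "0 < h" "h < d" "x + h < b" using d x by (auto simp: h_def min_def field_simps)
      have "integral {x..x + h} f = integral {x..x + h} e"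
        by (rule integral_cong) (use h x in \<open>auto simp: f_def\<close>)
      also have "\<dots> = 0"
        by (rule integral_Icc_eq_0_if_orthogonal[OF loc orth]) (use x h ab in auto)
      finally show False using d(2)[OF h(1,2)] by simp
    qed
    then show ?thesis using N(1) by blast
  qed
  define a where "a n = A + (B - A) / (real n + 2)" for n :: nat
  define b where "b n = B - (B - A) / (real n + 2)" for n :: nat
  have ab: "A < a n" "b n < B" for n
    using AB by (auto simp: a_def b_def)
  then have "\<forall>n. \<exists>N. negligible N \<and> (\<forall>x. a n < x \<and> x < b n \<and> x \<notin> N \<longrightarrow> e x = 0)"
    using ex by blast
  then obtain N where N: "\<And>n. negligible (N n)"
    "\<And>n x. a n < x \<Longrightarrow> x < b n \<Longrightarrow> x \<notin> N n \<Longrightarrow> e x = 0"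
    by metis
  have "negligible (\<Union>n. N n)"
    by (rule negligible_countable_Union) (use N in auto)
  then have "AE x in lebesgue. x \<notin> (\<Union>n. N n)"
    by (metis AE_not_in negligible_iff_null_sets)
  moreover have "e x = 0" if x: "x \<in> {A<..<B}" "x \<notin> (\<Union>n. N n)" for x
  proof -
    define t where "t = min (x - A) (B - x)"
    have t: "t > 0" using x by (auto simp: t_def)
    obtain n where "(B - A) / t < real n" using reals_Archimedean2 by blast
    then have "B - A < real n * t" using t by (simp add: divide_less_eq)
    also have "\<dots> \<le> (real n + 2) * t" using t by simp
    finally have "(B - A) / (real n + 2) < t" by (simp add: divide_less_eq mult.commute)
    then have "a n < x" "x < b n" by (auto simp: a_def b_def t_def)
    then show ?thesis using N(2) x(2) by blast
  qed
  ultimately have "AE x in lebesgue. x \<in> {A<..<B} \<longrightarrow> e x = 0"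
    by (auto elim: eventually_mono)
  then show ?thesis
    by (subst AE_restrict_space_iff) auto
qed

lemma weak_deriv_unique_AE:
  assumes AB: "A < B"
    and w1: "has_weak_deriv {A<..<B} f d\<^sub>1" and w2: "has_weak_deriv {A<..<B} f d\<^sub>2"
  shows "AE x in lebesgue_on {A<..<B}. d\<^sub>1 x = d\<^sub>2 x"
proof -
  have loc: "locally_integrable {A<..<B} d\<^sub>1" "locally_integrable {A<..<B} d\<^sub>2"
    using w1 w2 by (auto simp: has_weak_deriv_def)
  have "AE x in lebesgue_on {A<..<B}. d\<^sub>1 x - d\<^sub>2 x = 0"
  proof (rule AE_eq_0_if_orthogonal[OF AB])
    show "locally_integrable {A<..<B} (\<lambda>x. d\<^sub>1 x - d\<^sub>2 x)"
      using loc by (auto simp: locally_integrable_def)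
    fix \<phi> \<phi>' assume tf: "test_function {A<..<B} \<phi> \<phi>'"
    have e1: "(\<integral>x. f x * \<phi>' x \<partial>lebesgue_on {A<..<B}) = - (\<integral>x. d\<^sub>1 x * \<phi> x \<partial>lebesgue_on {A<..<B})"
      using w1 tf unfolding has_weak_deriv_def by blast
    have e2: "(\<integral>x. f x * \<phi>' x \<partial>lebesgue_on {A<..<B}) = - (\<integral>x. d\<^sub>2 x * \<phi> x \<partial>lebesgue_on {A<..<B})"
      using w2 tf unfolding has_weak_deriv_def by blast
    have "(\<integral>x. (d\<^sub>1 x - d\<^sub>2 x) * \<phi> x \<partial>lebesgue_on {A<..<B})
        = (\<integral>x. d\<^sub>1 x * \<phi> x \<partial>lebesgue_on {A<..<B}) - (\<integral>x. d\<^sub>2 x * \<phi> x \<partial>lebesgue_on {A<..<B})"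
      unfolding left_diff_distrib
      by (intro Bochner_Integration.integral_diff locally_integrable_times_test_function(1)[OF _ tf] loc) auto
    also have "\<dots> = 0"
      using e1 e2 by simp
    finally show "(\<integral>x. (d\<^sub>1 x - d\<^sub>2 x) * \<phi> x \<partial>lebesgue_on {A<..<B}) = 0" .
  qed
  then show ?thesis by simp
qed

lemma locally_integrable_measurable:
  fixes A B :: real
  assumes loc: "locally_integrable {A<..<B} f"
  shows "f \<in> borel_measurable (lebesgue_on {A<..<B})"
proof -
  define K where "K n = {A + 1 / real (Suc n)..B - 1 / real (Suc n)}" for n
  define u where "u n x = (if x \<in> K n then f x else 0)" for n x
  have K: "compact (K n)" "K n \<subseteq> {A<..<B}" for n
  proof -
    define e where "e = 1 / real (Suc n)"
    have "e > 0" by (simp add: e_def)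
    then show "compact (K n)" "K n \<subseteq> {A<..<B}"
      unfolding K_def e_def[symmetric] by auto
  qed
  have "u n \<in> borel_measurable (lebesgue_on {A<..<B})" for n
  proof -
    have "integrable (lebesgue_on (K n)) f"
      using loc K by (auto simp: locally_integrable_def)
    then have "u n \<in> borel_measurable lebesgue"
      unfolding u_def[abs_def] using K[of n]
      by (subst borel_measurable_if) (auto intro: lmeasurable_compact fmeasurableD)
    then show ?thesis by (rule measurable_restrict_space1)
  qed
  moreover have "(\<lambda>n. u n x) \<longlonglongrightarrow> f x" if "x \<in> space (lebesgue_on {A<..<B})" for x
  proof -
    define t where "t = min (x - A) (B - x)"
    have "t > 0" using that by (auto simp: t_def)
    then have "\<forall>\<^sub>F n in sequentially. inverse (real (Suc n)) < t"
      by (rule order_tendstoD(2)[OF LIMSEQ_inverse_real_of_nat])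
    then have "\<forall>\<^sub>F n in sequentially. f x = u n x"
      by eventually_elim (auto simp: u_def K_def t_def inverse_eq_divide)
    then show ?thesis by (rule Lim_transform_eventually[OF tendsto_const])
  qed
  ultimately show ?thesis by (rule borel_measurable_LIMSEQ_real[rotated])
qed

lemma has_weak_deriv_weak_deriv:
  "has_weak_deriv S v d \<Longrightarrow> has_weak_deriv S v (weak_deriv S v)"
  unfolding weak_deriv_def using someI[of "has_weak_deriv S v" d] by simp

section \<open>Integration by parts up to the endpoints\<close>

text \<open>A zero with nonzero derivative is isolated among the zeros, so a countable basis separates such
  zeros.\<close>

lemma countable_simple_zeros:
  fixes p p' :: "real \<Rightarrow> real"
  assumes der: "\<And>x. x \<in> S \<Longrightarrow> (p has_real_derivative p' x) (at x)"
  shows "countable {x \<in> S. p x = 0 \<and> p' x \<noteq> 0}" (is "countable ?Z")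
proof -
  obtain \<B> :: "real set set" where \<B>: "countable \<B>" "topological_basis \<B>"
    using ex_countable_basis by blast
  have ex: "\<exists>C. C \<in> \<B> \<and> x \<in> C \<and> (\<forall>y\<in>C. y \<noteq> x \<longrightarrow> p y \<noteq> 0)" if x: "x \<in> ?Z" for x
  proof -
    have "((\<lambda>y. (p y - p x) / (y - x)) \<longlongrightarrow> p' x) (at x)"
      using der[of x] x by (simp add: has_field_derivative_iff)
    then have "\<forall>\<^sub>F y in at x. (p y - p x) / (y - x) \<noteq> 0"
      by (rule tendsto_imp_eventually_ne) (use x in auto)
    then have "\<forall>\<^sub>F y in at x. p y \<noteq> 0"
      by (rule eventually_mono) (use x in auto)
    then obtain U where "open U" "x \<in> U" "\<And>y. y \<in> U \<Longrightarrow> y \<noteq> x \<Longrightarrow> p y \<noteq> 0"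
      unfolding eventually_at_topological by blast
    moreover from this obtain C where "C \<in> \<B>" "x \<in> C" "C \<subseteq> U"
      using topological_basisE[OF \<B>(2)] by metis
    ultimately show ?thesis by blast
  qed
  have "\<exists>g. \<forall>x\<in>?Z. g x \<in> \<B> \<and> x \<in> g x \<and> (\<forall>y\<in>g x. y \<noteq> x \<longrightarrow> p y \<noteq> 0)"
    by (rule bchoice) (use ex in blast)
  then obtain g where "\<forall>x\<in>?Z. g x \<in> \<B> \<and> x \<in> g x \<and> (\<forall>y\<in>g x. y \<noteq> x \<longrightarrow> p y \<noteq> 0)" ..
  note g = bspec[OF this]
  have "inj_on g ?Z"
  proof (rule inj_onI)
    fix x y assume xy: "x \<in> ?Z" "y \<in> ?Z" "g x = g y"
    have "y \<in> g x" using g[OF xy(2)] xy(3) by simp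
    moreover have "p y = 0" using xy(2) by simp
    ultimately show "x = y" using g[OF xy(1)] by metis
  qed
  moreover have "countable (g ` ?Z)"
  proof (rule countable_subset[OF _ \<B>(1)])
    show "g ` ?Z \<subseteq> \<B>"
    proof
      fix C assume "C \<in> g ` ?Z"
      then obtain x where "C = g x" "x \<in> ?Z" by (rule imageE)
      then show "C \<in> \<B>" using g by metis
    qed
  qed
  ultimately show ?thesis by (rule countable_image_inj_on[rotated])
qed

text \<open>An odd \<open>C\<^sup>1\<close> function that vanishes on \<open>[-1, 1]\<close> and is asymptotic to the identity;
  \<open>cutoff (n t) / n\<close> tends to \<open>t\<close> and vanishes for small \<open>t\<close>.\<close>

definition cutoff :: "real \<Rightarrow> real" where
  "cutoff t = t * (max 0 (t\<^sup>2 - 1) / (t\<^sup>2 + 1))\<^sup>2"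

definition cutoff_deriv :: "real \<Rightarrow> real" where
  "cutoff_deriv t = (let a = max 0 (t\<^sup>2 - 1) / (t\<^sup>2 + 1); b = t\<^sup>2 / (t\<^sup>2 + 1) in a\<^sup>2 + 4 * b * a * (1 - a))"

lemma cutoff_eq_0: "\<bar>t\<bar> \<le> 1 \<Longrightarrow> cutoff t = 0"
  by (simp add: cutoff_def abs_square_le_1)

lemma cutoff_ratio_bounds:
  fixes t :: real
  shows "0 \<le> max 0 (t\<^sup>2 - 1) / (t\<^sup>2 + 1)" "max 0 (t\<^sup>2 - 1) / (t\<^sup>2 + 1) \<le> 1"
    "0 \<le> t\<^sup>2 / (t\<^sup>2 + 1)" "t\<^sup>2 / (t\<^sup>2 + 1) \<le> 1"
proof -
  have "0 < t\<^sup>2 + 1" by (smt (verit) zero_le_power2)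
  then show "0 \<le> max 0 (t\<^sup>2 - 1) / (t\<^sup>2 + 1)" "max 0 (t\<^sup>2 - 1) / (t\<^sup>2 + 1) \<le> 1"
    "0 \<le> t\<^sup>2 / (t\<^sup>2 + 1)" "t\<^sup>2 / (t\<^sup>2 + 1) \<le> 1"
    by (auto simp: divide_le_eq)
qed

lemma abs_cutoff_le: "\<bar>cutoff t\<bar> \<le> \<bar>t\<bar>"
proof -
  have "(max 0 (t\<^sup>2 - 1) / (t\<^sup>2 + 1))\<^sup>2 \<le> 1"
    using cutoff_ratio_bounds[of t] by (intro power_le_one) auto
  then show ?thesis
    using mult_left_le[of "(max 0 (t\<^sup>2 - 1) / (t\<^sup>2 + 1))\<^sup>2" "\<bar>t\<bar>"]
    by (simp add: cutoff_def abs_mult)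
qed

lemma abs_cutoff_deriv_le: "\<bar>cutoff_deriv t\<bar> \<le> 5"
proof -
  define a where "a = max 0 (t\<^sup>2 - 1) / (t\<^sup>2 + 1)"
  define b where "b = t\<^sup>2 / (t\<^sup>2 + 1)"
  have ab: "0 \<le> a" "a \<le> 1" "0 \<le> b" "b \<le> 1"
    unfolding a_def b_def by (rule cutoff_ratio_bounds)+
  have "a\<^sup>2 \<le> 1" using ab by (intro power_le_one)
  moreover have "b * a * (1 - a) \<le> 1 * 1 * 1"
    using ab by (intro mult_mono) auto
  moreover have "0 \<le> b * a * (1 - a)" using ab by auto
  moreover have "cutoff_deriv t = a\<^sup>2 + 4 * (b * a * (1 - a))"
    by (simp add: cutoff_deriv_def Let_def a_def b_def)
  ultimately show ?thesis using zero_le_power2[of a] by linarith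
qed

lemma has_real_derivative_cutoff: "(cutoff has_real_derivative cutoff_deriv t) (at t)"
proof -
  define s where "s = t\<^sup>2 + 1"
  define M where "M = max 0 (t\<^sup>2 - 1)"
  have s0: "s > 0" unfolding s_def by (smt (verit) zero_le_power2)
  have "((\<lambda>t. t\<^sup>2 - 1) has_real_derivative 2 * t) (at t)"
    by (auto intro!: derivative_eq_intros)
  then have d1: "((\<lambda>t. (max 0 (t\<^sup>2 - 1))\<^sup>2) has_real_derivative 2 * M * (2 * t)) (at t)"
    unfolding M_def by (rule DERIV_chain2[OF has_real_derivative_max_0_square])
  have d2: "((\<lambda>t. (t\<^sup>2 + 1)\<^sup>2) has_real_derivative 2 * s * (2 * t)) (at t)"
    unfolding s_def by (auto intro!: derivative_eq_intros)
  have ne: "(t\<^sup>2 + 1)\<^sup>2 \<noteq> 0" using s0 by (simp add: s_def)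
  have "((\<lambda>t. t * ((max 0 (t\<^sup>2 - 1))\<^sup>2 / (t\<^sup>2 + 1)\<^sup>2)) has_real_derivative cutoff_deriv t) (at t)"
  proof (rule DERIV_cong[OF DERIV_mult[OF DERIV_ident DERIV_divide[OF d1 d2 ne]]])
    show "1 * ((max 0 (t\<^sup>2 - 1))\<^sup>2 / (t\<^sup>2 + 1)\<^sup>2) +
        (2 * M * (2 * t) * (t\<^sup>2 + 1)\<^sup>2 - (max 0 (t\<^sup>2 - 1))\<^sup>2 * (2 * s * (2 * t))) /
        ((t\<^sup>2 + 1)\<^sup>2 * (t\<^sup>2 + 1)\<^sup>2) * t = cutoff_deriv t"
      unfolding cutoff_deriv_def Let_def M_def[symmetric] s_def[symmetric]
      using s0 by (simp add: field_simps power2_eq_square)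
  qed
  moreover have "cutoff = (\<lambda>t. t * ((max 0 (t\<^sup>2 - 1))\<^sup>2 / (t\<^sup>2 + 1)\<^sup>2))"
    by (simp add: fun_eq_iff cutoff_def power_divide)
  ultimately show ?thesis by simp
qed

lemma continuous_cutoff_deriv: "continuous_on UNIV cutoff_deriv"
proof -
  have "t\<^sup>2 + 1 \<noteq> 0" for t :: real by (smt (verit) zero_le_power2)
  then show ?thesis
    unfolding cutoff_deriv_def Let_def by (intro continuous_intros) auto
qed

lemma cutoff_limits:
  fixes t :: real
  assumes "t \<noteq> 0"
  shows "(\<lambda>n. cutoff (real (Suc n) * t) / real (Suc n)) \<longlonglongrightarrow> t"
    "(\<lambda>n. cutoff_deriv (real (Suc n) * t)) \<longlonglongrightarrow> 1"
proof -
  define y where "y n = 1 / ((real (Suc n) * t)\<^sup>2 + 1)" for n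
  define a where "a n = max 0 ((real (Suc n) * t)\<^sup>2 - 1) / ((real (Suc n) * t)\<^sup>2 + 1)" for n
  define b where "b n = (real (Suc n) * t)\<^sup>2 / ((real (Suc n) * t)\<^sup>2 + 1)" for n
  have pos: "(real (Suc n) * t)\<^sup>2 + 1 > 0" for n by (smt (verit) zero_le_power2)
  have y0: "y \<longlonglongrightarrow> 0"
  proof (rule Lim_null_comparison)
    show "\<forall>\<^sub>F n in sequentially. norm (y n) \<le> (1 / t\<^sup>2) * inverse (real (Suc n))"
    proof (intro always_eventually allI)
      fix n
      have "real (Suc n) * 1 \<le> real (Suc n) * real (Suc n)" by (intro mult_left_mono) auto
      then have "real (Suc n) * t\<^sup>2 \<le> (real (Suc n) * t)\<^sup>2 + 1"
        using mult_right_mono[of "real (Suc n)" "real (Suc n) * real (Suc n)" "t\<^sup>2"]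
        by (simp add: power2_eq_square algebra_simps)
      moreover have "0 < real (Suc n) * t\<^sup>2" using assms by simp
      ultimately have "y n \<le> 1 / (real (Suc n) * t\<^sup>2)"
        unfolding y_def by (intro divide_left_mono) (use pos[of n] in auto)
      moreover have "0 \<le> y n" using pos[of n] by (simp add: y_def)
      ultimately show "norm (y n) \<le> (1 / t\<^sup>2) * inverse (real (Suc n))"
        by (simp add: field_simps)
    qed
    show "(\<lambda>n. (1 / t\<^sup>2) * inverse (real (Suc n))) \<longlonglongrightarrow> 0"
      using tendsto_mult_right_zero[OF LIMSEQ_inverse_real_of_nat] by blast
  qed
  have a_eq: "a n = max 0 (1 - 2 * y n)" for n
  proof -
    have "a n = max (0 / ((real (Suc n) * t)\<^sup>2 + 1)) (((real (Suc n) * t)\<^sup>2 - 1) / ((real (Suc n) * t)\<^sup>2 + 1))"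
      unfolding a_def using pos[of n] by (simp add: max_divide_distrib_right)
    also have "((real (Suc n) * t)\<^sup>2 - 1) / ((real (Suc n) * t)\<^sup>2 + 1) = 1 - 2 * y n"
      unfolding y_def using pos[of n] by (simp add: field_simps)
    finally show ?thesis by simp
  qed
  have "(\<lambda>n. max 0 (1 - 2 * y n)) \<longlonglongrightarrow> max 0 (1 - 2 * 0)"
    by (intro tendsto_intros y0)
  then have a1: "a \<longlonglongrightarrow> 1" by (simp add: a_eq[abs_def])
  have b_eq: "b n = 1 - y n" for n
    unfolding b_def y_def using pos[of n] by (simp add: field_simps)
  then have b1: "b \<longlonglongrightarrow> 1"
    using tendsto_diff[OF tendsto_const[of 1] y0] by (simp add: b_eq[abs_def])
  have "(\<lambda>n. t * (a n)\<^sup>2) \<longlonglongrightarrow> t * 1\<^sup>2"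
    by (intro tendsto_intros a1)
  moreover have "cutoff (real (Suc n) * t) / real (Suc n) = t * (a n)\<^sup>2" for n
    by (simp add: cutoff_def a_def del: of_nat_Suc)
  ultimately show "(\<lambda>n. cutoff (real (Suc n) * t) / real (Suc n)) \<longlonglongrightarrow> t" by simp
  have "(\<lambda>n. (a n)\<^sup>2 + 4 * b n * a n * (1 - a n)) \<longlonglongrightarrow> 1\<^sup>2 + 4 * 1 * 1 * (1 - 1)"
    by (intro tendsto_intros a1 b1)
  then show "(\<lambda>n. cutoff_deriv (real (Suc n) * t)) \<longlonglongrightarrow> 1"
    by (simp add: cutoff_deriv_def Let_def a_def b_def)
qed

text \<open>The compositions \<open>cutoff (n p) / n\<close> are admissible test functions because \<open>p\<close> is small near
  both ends.  Their derivatives converge to \<open>p'\<close> except at simple zeros of \<open>p\<close>, which are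
  countably many.\<close>

lemma weak_deriv_by_parts:
  assumes AB: "A < B" and wd: "has_weak_deriv {A<..<B} f d"
    and der: "\<And>x. x \<in> {A<..<B} \<Longrightarrow> (p has_real_derivative p' x) (at x)"
    and cont: "continuous_on {A<..<B} p'"
    and lims: "(p \<longlongrightarrow> 0) (at_right A)" "(p \<longlongrightarrow> 0) (at_left B)"
    and int: "integrable (lebesgue_on {A<..<B}) (\<lambda>x. f x * p' x)"
      "integrable (lebesgue_on {A<..<B}) (\<lambda>x. d x * p x)"
  shows "(\<integral>x. f x * p' x \<partial>lebesgue_on {A<..<B}) = - (\<integral>x. d x * p x \<partial>lebesgue_on {A<..<B})"
proof -
  let ?S = "{A<..<B}" and ?L = "lebesgue_on {A<..<B}"
  define \<phi> where "\<phi> n x = (if x \<in> ?S then cutoff (real (Suc n) * p x) / real (Suc n) else 0)" for n x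
  define \<phi>' where "\<phi>' n x = (if x \<in> ?S then cutoff_deriv (real (Suc n) * p x) * p' x else 0)" for n x
  have cp: "continuous_on ?S p"
    by (rule DERIV_continuous_on[OF has_field_derivative_at_within[OF der]])
  have tf: "test_function ?S (\<phi> n) (\<phi>' n)" for n
  proof -
    have "\<forall>\<^sub>F x in at_right A. \<bar>p x\<bar> < 1 / real (Suc n)"
      using tendstoD[OF lims(1), of "1 / real (Suc n)"] by simp
    then obtain a where a: "A < a" "\<And>x. A < x \<Longrightarrow> x < a \<Longrightarrow> \<bar>p x\<bar> < 1 / real (Suc n)"
      unfolding eventually_at_right_field by blast
    have "\<forall>\<^sub>F x in at_left B. \<bar>p x\<bar> < 1 / real (Suc n)"
      using tendstoD[OF lims(2), of "1 / real (Suc n)"] by simp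
    then obtain b where b: "b < B" "\<And>x. b < x \<Longrightarrow> x < B \<Longrightarrow> \<bar>p x\<bar> < 1 / real (Suc n)"
      unfolding eventually_at_left_field by blast
    show ?thesis
      unfolding \<phi>_def \<phi>'_def
    proof (rule test_function_extend_0)
      show "open ?S" by simp
      show "compact {a..b}" by simp
      show "{a..b} \<subseteq> ?S" using a b by auto
      fix x assume x: "x \<in> ?S"
      have "((\<lambda>x. real (Suc n) * p x) has_real_derivative real (Suc n) * p' x) (at x)"
        by (rule DERIV_cmult[OF der[OF x]])
      from DERIV_cdivide[OF DERIV_chain2[OF has_real_derivative_cutoff this], of "real (Suc n)"]
      show "((\<lambda>x. cutoff (real (Suc n) * p x) / real (Suc n)) has_real_derivative
          cutoff_deriv (real (Suc n) * p x) * p' x) (at x)"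
        by (simp add: field_simps del: of_nat_Suc)
      assume "x \<notin> {a..b}"
      then have "\<bar>p x\<bar> < 1 / real (Suc n)" using a b x by fastforce
      then have "\<bar>real (Suc n) * p x\<bar> \<le> 1"
        by (simp add: abs_mult field_simps del: of_nat_Suc)
      then show "cutoff (real (Suc n) * p x) / real (Suc n) = 0"
        by (simp add: cutoff_eq_0)
    next
      show "continuous_on ?S (\<lambda>x. cutoff_deriv (real (Suc n) * p x) * p' x)"
        by (intro continuous_on_mult cont continuous_on_compose2[OF continuous_cutoff_deriv]
            continuous_on_const cp) auto
    qed
  qed
  have loc: "locally_integrable ?S f" "locally_integrable ?S d"
    and eq: "\<And>\<phi> \<phi>'. test_function ?S \<phi> \<phi>' \<Longrightarrow> (\<integral>x. f x * \<phi>' x \<partial>?L) = - (\<integral>x. d x * \<phi> x \<partial>?L)"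
    using wd unfolding has_weak_deriv_def by blast+
  have "(\<lambda>n. \<integral>x. d x * \<phi> n x \<partial>?L) \<longlonglongrightarrow> (\<integral>x. d x * p x \<partial>?L)"
  proof (rule integral_dominated_convergence)
    show "integrable ?L (\<lambda>x. \<bar>d x * p x\<bar>)" using int by simp
    show "(\<lambda>x. d x * p x) \<in> borel_measurable ?L" using int by simp
    show "(\<lambda>x. d x * \<phi> n x) \<in> borel_measurable ?L" for n
      using locally_integrable_times_test_function(1)[OF loc(2) tf] by auto
    show "AE x in ?L. norm (d x * \<phi> n x) \<le> \<bar>d x * p x\<bar>" for n
    proof (rule AE_I2)
      fix x
      have "\<bar>\<phi> n x\<bar> \<le> \<bar>p x\<bar>"
        using abs_cutoff_le[of "real (Suc n) * p x"]
        by (simp add: \<phi>_def abs_mult divide_le_eq mult.commute del: of_nat_Suc)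
      then show "norm (d x * \<phi> n x) \<le> \<bar>d x * p x\<bar>"
        by (simp add: abs_mult mult_left_mono)
    qed
    show "AE x in ?L. (\<lambda>n. d x * \<phi> n x) \<longlonglongrightarrow> d x * p x"
    proof (rule AE_I2)
      fix x assume "x \<in> space ?L"
      then have x: "x \<in> ?S" by simp
      have "(\<lambda>n. \<phi> n x) \<longlonglongrightarrow> p x"
      proof (cases "p x = 0")
        case True
        then have "\<phi> n x = 0" for n by (simp add: \<phi>_def cutoff_eq_0)
        then show ?thesis using True by simp
      next
        case False
        show ?thesis using cutoff_limits(1)[OF False] x by (simp add: \<phi>_def)
      qed
      then show "(\<lambda>n. d x * \<phi> n x) \<longlonglongrightarrow> d x * p x"
        by (rule tendsto_mult_left)
    qed
  qed
  moreover have "(\<lambda>n. \<integral>x. f x * \<phi>' n x \<partial>?L) \<longlonglongrightarrow> (\<integral>x. f x * p' x \<partial>?L)"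
  proof (rule integral_dominated_convergence)
    show "integrable ?L (\<lambda>x. 5 * \<bar>f x * p' x\<bar>)" using int by simp
    show "(\<lambda>x. f x * p' x) \<in> borel_measurable ?L" using int by simp
    show "(\<lambda>x. f x * \<phi>' n x) \<in> borel_measurable ?L" for n
      using locally_integrable_times_test_function(2)[OF loc(1) tf] by auto
    show "AE x in ?L. norm (f x * \<phi>' n x) \<le> 5 * \<bar>f x * p' x\<bar>" for n
    proof (rule AE_I2)
      fix x
      have "\<bar>\<phi>' n x\<bar> \<le> 5 * \<bar>p' x\<bar>"
        using mult_right_mono[OF abs_cutoff_deriv_le[of "real (Suc n) * p x"], of "\<bar>p' x\<bar>"]
        by (simp add: \<phi>'_def abs_mult del: of_nat_Suc)
      then show "norm (f x * \<phi>' n x) \<le> 5 * \<bar>f x * p' x\<bar>"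
        using mult_left_mono[of "\<bar>\<phi>' n x\<bar>" "5 * \<bar>p' x\<bar>" "\<bar>f x\<bar>"] by (simp add: abs_mult mult.left_commute)
    qed
    \<comment> \<open>At a zero of \<open>p\<close> the derivatives \<open>\<phi>' n\<close> all vanish, so the limit is right only if \<open>p'\<close> vanishes too.\<close>
    have "{x \<in> ?S. p x = 0 \<and> p' x \<noteq> 0} \<in> null_sets lebesgue"
      using countable_simple_zeros[of ?S p p', OF der] by (auto intro!: null_sets_completionI countable_imp_null_set_lborel)
    then have "AE x in lebesgue. x \<notin> {x \<in> ?S. p x = 0 \<and> p' x \<noteq> 0}"
      by (rule AE_not_in)
    then have "AE x in ?L. p x \<noteq> 0 \<or> p' x = 0"
      by (subst AE_restrict_space_iff) (auto elim: eventually_mono)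
    then show "AE x in ?L. (\<lambda>n. f x * \<phi>' n x) \<longlonglongrightarrow> f x * p' x"
    proof (rule AE_mp, intro AE_I2 impI)
      fix x assume "x \<in> space ?L" and cases: "p x \<noteq> 0 \<or> p' x = 0"
      then have x: "x \<in> ?S" by simp
      have "(\<lambda>n. \<phi>' n x) \<longlonglongrightarrow> p' x"
      proof (cases "p' x = 0")
        case True
        then have "\<phi>' n x = 0" for n by (simp add: \<phi>'_def)
        then show ?thesis using True by simp
      next
        case False
        then have "p x \<noteq> 0" using cases by simp
        from tendsto_mult_right[OF cutoff_limits(2)[OF this], of "p' x"] x
        show ?thesis by (simp add: \<phi>'_def)
      qed
      then show "(\<lambda>n. f x * \<phi>' n x) \<longlonglongrightarrow> f x * p' x"
        by (rule tendsto_mult_left)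
    qed
  qed
  then have "(\<lambda>n. - (\<integral>x. d x * \<phi> n x \<partial>?L)) \<longlonglongrightarrow> (\<integral>x. f x * p' x \<partial>?L)"
    by (simp add: eq[OF tf])
  then show ?thesis
    using calculation LIMSEQ_unique tendsto_minus by blast
qed

section \<open>The weighted space\<close>

lemma has_real_derivative_wgt:
  assumes "r > 0"
  shows "(wgt m has_real_derivative wgt m r * (m / r - r)) (at r)"
proof -
  have "((\<lambda>r. r powr m * exp (- r\<^sup>2 / 2)) has_real_derivative
      (m * r powr (m - 1)) * exp (- r\<^sup>2 / 2) + r powr m * (exp (- r\<^sup>2 / 2) * (- r))) (at r)"
    using assms by (auto intro!: derivative_eq_intros simp: powr_diff)
  moreover have "r powr (m - 1) = r powr m / r"
    using assms by (simp add: powr_diff)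
  ultimately show ?thesis
    by (simp add: wgt_def[abs_def] algebra_simps)
qed

locale gaussian_interval =
  fixes m R :: real
  assumes m: "m > 1" and R: "R > 0"
begin

lemma wgt_pos: "r > 0 \<Longrightarrow> wgt m r > 0"
  by (simp add: wgt_def)

lemma wgt_le: "r > 0 \<Longrightarrow> wgt m r \<le> r powr m"
  unfolding wgt_def by (rule mult_left_le) auto

lemma continuous_wgt: "continuous_on {0<..} (wgt m)"
  by (rule DERIV_continuous_on[OF has_field_derivative_at_within[OF has_real_derivative_wgt]]) auto

lemma continuous_on_measurable:
  "continuous_on {0<..<R} f \<Longrightarrow> (f :: real \<Rightarrow> real) \<in> borel_measurable (lebesgue_on {0<..<R})"
  by (rule continuous_imp_measurable_on_sets_lebesgue) auto

lemma wgt_measurable: "wgt m \<in> borel_measurable (lebesgue_on {0<..<R})"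
  by (rule continuous_on_measurable[OF continuous_on_subset[OF continuous_wgt]]) auto

lemma finite_measure_interval: "finite_measure (lebesgue_on {0<..<R})"
  by (rule finite_measure_lebesgue_on) auto

lemma integrable_wgt: "integrable (lebesgue_on {0<..<R}) (wgt m)"
proof (rule finite_measure.integrable_const_bound[OF finite_measure_interval _ wgt_measurable])
  show "AE r in lebesgue_on {0<..<R}. norm (wgt m r) \<le> R powr m"
  proof (rule AE_I2)
    fix r assume "r \<in> space (lebesgue_on {0<..<R})"
    then have r: "0 < r" "r < R" by auto
    then have "r powr m \<le> R powr m" using m by (intro powr_mono2) auto
    then show "norm (wgt m r) \<le> R powr m"
      using wgt_le[OF r(1)] wgt_pos[OF r(1)] by simp
  qed
qed

lemma Wgt_pos: "Wgt m R > 0"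
proof -
  have nn: "AE r in lebesgue_on {0<..<R}. 0 \<le> wgt m r"
    by (intro AE_I2) (auto intro: less_imp_le wgt_pos)
  have "Wgt m R \<noteq> 0"
  proof
    assume "Wgt m R = 0"
    then have "AE r in lebesgue_on {0<..<R}. wgt m r = 0"
      using integral_nonneg_eq_0_iff_AE[OF integrable_wgt nn] by (simp add: Wgt_def)
    then have "AE r in lebesgue_on {0<..<R}. False"
    proof (rule AE_mp, intro AE_I2 impI)
      fix r assume "r \<in> space (lebesgue_on {0<..<R})" "wgt m r = 0"
      then show False using wgt_pos[of r] by simp
    qed
    then have "emeasure (lebesgue_on {0<..<R}) (space (lebesgue_on {0<..<R})) = 0"
      by (subst (asm) AE_iff_measurable[where N="space (lebesgue_on {0<..<R})"]) auto
    then show False using R by (simp add: emeasure_restrict_space)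
  qed
  moreover have "Wgt m R \<ge> 0"
    unfolding Wgt_def by (rule integral_nonneg_AE[OF nn])
  ultimately show ?thesis by simp
qed

lemma sets_mu [simp]: "sets (mu m R) = sets (lebesgue_on {0<..<R})"
  by (simp add: mu_def)

lemma measurable_mu: "borel_measurable (mu m R) = borel_measurable (lebesgue_on {0<..<R})"
  by (rule measurable_cong_sets) auto

lemma density_measurable: "(\<lambda>r. wgt m r / Wgt m R) \<in> borel_measurable (lebesgue_on {0<..<R})"
  using wgt_measurable by (rule borel_measurable_divide) simp

lemma AE_mu_iff: "(AE r in mu m R. P r) \<longleftrightarrow> (AE r in lebesgue_on {0<..<R}. P r)"
proof -
  have "(AE r in mu m R. P r) \<longleftrightarrow> (AE r in lebesgue_on {0<..<R}. 0 < ennreal (wgt m r / Wgt m R) \<longrightarrow> P r)"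
    unfolding mu_def using density_measurable by (subst AE_density) auto
  also have "\<dots> \<longleftrightarrow> (AE r in lebesgue_on {0<..<R}. P r)"
    by (rule AE_cong) (auto simp: wgt_pos Wgt_pos)
  finally show ?thesis .
qed

lemma density_nonneg: "AE r in lebesgue_on {0<..<R}. 0 \<le> wgt m r / Wgt m R"
  by (intro AE_I2) (auto intro!: divide_nonneg_pos less_imp_le[OF wgt_pos] Wgt_pos)

lemma integrable_mu_iff:
  fixes f :: "real \<Rightarrow> real"
  assumes "f \<in> borel_measurable (lebesgue_on {0<..<R})"
  shows "integrable (mu m R) f \<longleftrightarrow> integrable (lebesgue_on {0<..<R}) (\<lambda>r. f r * wgt m r)"
proof -
  have "integrable (mu m R) f \<longleftrightarrow> integrable (lebesgue_on {0<..<R}) (\<lambda>r. (wgt m r / Wgt m R) *\<^sub>R f r)"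
    unfolding mu_def by (rule integrable_density[OF assms density_measurable density_nonneg])
  also have "(\<lambda>r. (wgt m r / Wgt m R) *\<^sub>R f r) = (\<lambda>r. (f r * wgt m r) * (1 / Wgt m R))"
    by (simp add: fun_eq_iff)
  finally show ?thesis
    using Wgt_pos integrable_mult_left_iff[where M="lebesgue_on {0<..<R}" and f="\<lambda>r. f r * wgt m r" and c="1 / Wgt m R"] by auto
qed

lemma Ex_eq:
  fixes f :: "real \<Rightarrow> real"
  assumes "f \<in> borel_measurable (lebesgue_on {0<..<R})"
  shows "Ex m R f = (\<integral>r. f r * wgt m r \<partial>lebesgue_on {0<..<R}) / Wgt m R"
proof -
  have "Ex m R f = (\<integral>r. (wgt m r / Wgt m R) *\<^sub>R f r \<partial>lebesgue_on {0<..<R})"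
    unfolding mu_def Ex_def by (rule integral_density[OF assms density_measurable density_nonneg])
  also have "(\<lambda>r. (wgt m r / Wgt m R) *\<^sub>R f r) = (\<lambda>r. (f r * wgt m r) / Wgt m R)"
    by (simp add: fun_eq_iff)
  finally show ?thesis by simp
qed

lemma Ex_const: "Ex m R (\<lambda>r. a) = a"
proof -
  have "Ex m R (\<lambda>r. a) = (\<integral>r. a * wgt m r \<partial>lebesgue_on {0<..<R}) / Wgt m R"
    by (rule Ex_eq) simp
  also have "\<dots> = a" using Wgt_pos by (simp add: Wgt_def[symmetric])
  finally show ?thesis .
qed

lemma L2w_measurable:
  "f \<in> L2w m R \<Longrightarrow> f \<in> borel_measurable (lebesgue_on {0<..<R})"
  by (simp add: L2w_def)

lemma L2w_iff:
  "f \<in> L2w m R \<longleftrightarrow> f \<in> borel_measurable (lebesgue_on {0<..<R}) \<and> integrable (mu m R) (\<lambda>r. (f r)\<^sup>2)"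
proof (cases "f \<in> borel_measurable (lebesgue_on {0<..<R})")
  case True
  then have "(\<lambda>r. (f r)\<^sup>2) \<in> borel_measurable (lebesgue_on {0<..<R})" by simp
  from integrable_mu_iff[OF this] True show ?thesis by (simp add: L2w_def)
qed (simp add: L2w_def)

lemma L2w_bounded_mult:
  assumes f: "f \<in> L2w m R" and h: "h \<in> borel_measurable (lebesgue_on {0<..<R})"
    and le: "\<And>r. r \<in> {0<..<R} \<Longrightarrow> \<bar>h r\<bar> \<le> C * \<bar>f r\<bar>"
  shows "h \<in> L2w m R"
  unfolding L2w_iff
proof (intro conjI h)
  show "integrable (mu m R) (\<lambda>r. (h r)\<^sup>2)"
  proof (rule Bochner_Integration.integrable_bound)
    show "integrable (mu m R) (\<lambda>r. C\<^sup>2 * (f r)\<^sup>2)" using f by (simp add: L2w_iff)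
    show "(\<lambda>r. (h r)\<^sup>2) \<in> borel_measurable (mu m R)" using h by (simp add: measurable_mu)
    show "AE r in mu m R. norm ((h r)\<^sup>2) \<le> norm (C\<^sup>2 * (f r)\<^sup>2)"
      unfolding AE_mu_iff
    proof (rule AE_I2)
      fix r assume "r \<in> space (lebesgue_on {0<..<R})"
      then have "\<bar>h r\<bar>\<^sup>2 \<le> (C * \<bar>f r\<bar>)\<^sup>2" using le by (intro power_mono) auto
      then show "norm ((h r)\<^sup>2) \<le> norm (C\<^sup>2 * (f r)\<^sup>2)" by (simp add: power_mult_distrib)
    qed
  qed
qed

lemma L2w_mult_integrable:
  assumes f: "f \<in> L2w m R" and g: "g \<in> L2w m R"
  shows "integrable (mu m R) (\<lambda>r. f r * g r)"
proof (rule Bochner_Integration.integrable_bound)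
  show "integrable (mu m R) (\<lambda>r. (f r)\<^sup>2 + (g r)\<^sup>2)"
    using f g by (auto simp: L2w_iff)
  show "(\<lambda>r. f r * g r) \<in> borel_measurable (mu m R)"
    using f g by (auto simp: L2w_iff measurable_mu)
  show "AE r in mu m R. norm (f r * g r) \<le> norm ((f r)\<^sup>2 + (g r)\<^sup>2)"
  proof (intro always_eventually allI)
    fix r
    have "0 \<le> (\<bar>f r\<bar> - \<bar>g r\<bar>)\<^sup>2" "0 \<le> \<bar>f r\<bar> * \<bar>g r\<bar>" by auto
    then have "\<bar>f r\<bar> * \<bar>g r\<bar> \<le> (f r)\<^sup>2 + (g r)\<^sup>2"
      by (simp only: power2_diff power2_abs)
    then show "norm (f r * g r) \<le> norm ((f r)\<^sup>2 + (g r)\<^sup>2)"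
      by (simp add: abs_mult)
  qed
qed

lemma L2w_const: "(\<lambda>r. a) \<in> L2w m R"
  using integrable_wgt by (simp add: L2w_def)

lemma L2w_integrable: "f \<in> L2w m R \<Longrightarrow> integrable (mu m R) f"
  using L2w_mult_integrable[OF _ L2w_const[of 1]] by simp

lemma L2w_cmult: "f \<in> L2w m R \<Longrightarrow> (\<lambda>r. a * f r) \<in> L2w m R"
  by (rule L2w_bounded_mult[where C="\<bar>a\<bar>", OF _ borel_measurable_times[OF borel_measurable_const L2w_measurable]])
    (auto simp: abs_mult)

lemma L2w_times_ident: "f \<in> L2w m R \<Longrightarrow> (\<lambda>r. r * f r) \<in> L2w m R"
  by (rule L2w_bounded_mult[where C=R, OF _ borel_measurable_times[OF continuous_on_measurable[OF continuous_on_id] L2w_measurable]])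
    (auto simp: abs_mult intro!: mult_right_mono)

lemma L2w_add:
  assumes f: "f \<in> L2w m R" and g: "g \<in> L2w m R"
  shows "(\<lambda>r. f r + g r) \<in> L2w m R"
proof -
  have "integrable (mu m R) (\<lambda>r. (f r)\<^sup>2 + 2 * (f r * g r) + (g r)\<^sup>2)"
    using f g L2w_mult_integrable[OF f g] by (auto simp: L2w_iff)
  moreover have "(\<lambda>r. (f r)\<^sup>2 + 2 * (f r * g r) + (g r)\<^sup>2) = (\<lambda>r. (f r + g r)\<^sup>2)"
    by (simp add: fun_eq_iff power2_sum)
  ultimately show ?thesis
    using borel_measurable_add[OF L2w_measurable[OF f] L2w_measurable[OF g]] by (simp add: L2w_iff)
qed

lemma L2w_diff: "f \<in> L2w m R \<Longrightarrow> g \<in> L2w m R \<Longrightarrow> (\<lambda>r. f r - g r) \<in> L2w m R"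
  using L2w_add[of f "\<lambda>r. (-1) * g r"] L2w_cmult[of g "-1"] by simp

lemmas L2w_intros = L2w_add L2w_diff L2w_cmult L2w_times_ident L2w_const

lemma Ex_add: "f \<in> L2w m R \<Longrightarrow> g \<in> L2w m R \<Longrightarrow> Ex m R (\<lambda>r. f r + g r) = Ex m R f + Ex m R g"
  unfolding Ex_def by (intro Bochner_Integration.integral_add L2w_integrable)

lemma Ex_cmult: "Ex m R (\<lambda>r. a * f r) = a * Ex m R f"
  unfolding Ex_def by simp

text \<open>This single expansion serves every completion of squares below; variances are the case of a
  constant shift.\<close>

lemma Ex_square_expand:
  assumes f: "f \<in> L2w m R" and g: "g \<in> L2w m R"
  shows "Ex m R (\<lambda>r. (f r + a * g r + b)\<^sup>2)
    = Ex m R (\<lambda>r. (f r)\<^sup>2) + a\<^sup>2 * Ex m R (\<lambda>r. (g r)\<^sup>2) + b\<^sup>2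
      + 2 * a * Ex m R (\<lambda>r. f r * g r) + 2 * b * Ex m R f + 2 * a * b * Ex m R g"
proof -
  have i: "integrable (mu m R) (\<lambda>r. (f r)\<^sup>2)" "integrable (mu m R) (\<lambda>r. (g r)\<^sup>2)"
    "integrable (mu m R) (\<lambda>r. f r * g r)" "integrable (mu m R) f" "integrable (mu m R) g"
    "integrable (mu m R) (\<lambda>r. b\<^sup>2)"
    using f g L2w_integrable[OF f] L2w_integrable[OF g] L2w_mult_integrable[OF f g]
      L2w_integrable[OF L2w_const[of "b\<^sup>2"]] by (simp_all add: L2w_iff)
  have "(\<lambda>r. (f r + a * g r + b)\<^sup>2) = (\<lambda>r. (f r)\<^sup>2 + a\<^sup>2 * (g r)\<^sup>2 + b\<^sup>2
      + 2 * a * (f r * g r) + 2 * b * f r + 2 * a * b * g r)"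
    by (simp add: fun_eq_iff power2_eq_square algebra_simps)
  then show ?thesis
    using i Ex_const[of "b\<^sup>2"] by (simp add: Ex_def)
qed

lemma Var_eq:
  assumes f: "f \<in> L2w m R"
  shows "Var m R f = Ex m R (\<lambda>r. (f r)\<^sup>2) - (Ex m R f)\<^sup>2"
  using Ex_square_expand[OF f f, of 0 "- Ex m R f"]
  by (simp add: Var_def power2_eq_square)

lemma Ex_square_nonneg: "0 \<le> Ex m R (\<lambda>r. (f r)\<^sup>2)"
  unfolding Ex_def by (rule integral_nonneg_AE) auto

lemma Ex_square_eq_0_imp:
  assumes "f \<in> L2w m R" "Ex m R (\<lambda>r. (f r)\<^sup>2) = 0"
  shows "AE r in lebesgue_on {0<..<R}. f r = 0"
proof -
  have "AE r in mu m R. (f r)\<^sup>2 = 0"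
    using assms by (subst integral_nonneg_eq_0_iff_AE[symmetric]) (auto simp: L2w_iff Ex_def)
  then show ?thesis by (simp add: AE_mu_iff)
qed

lemma Ex_cong_AE:
  assumes "AE r in lebesgue_on {0<..<R}. f r = g r"
    "f \<in> borel_measurable (lebesgue_on {0<..<R})" "g \<in> borel_measurable (lebesgue_on {0<..<R})"
  shows "Ex m R f = Ex m R g"
  unfolding Ex_def using assms by (intro integral_cong_AE) (auto simp: measurable_mu AE_mu_iff)

text \<open>If \<open>w q\<close> had a nonzero limit, then \<open>q\<^sup>2 w\<close> would be at least of order \<open>1 / w\<close>, hence at
  least of order \<open>1 / r\<close>, which is not integrable at the origin.\<close>

lemma wgt_L2w_limit_eq_0:
  assumes q: "q \<in> L2w m R" and lim: "((\<lambda>r. wgt m r * q r) \<longlongrightarrow> l) (at_right 0)"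
  shows "l = 0"
proof (rule ccontr)
  assume l: "l \<noteq> 0"
  define k where "k = l\<^sup>2 / 4"
  have k: "k > 0" using l by (simp add: k_def)
  define f where "f r = (q r)\<^sup>2 * wgt m r" for r
  define I where "I = integral {0<..<R} f"
  have fi: "f integrable_on {0<..<R}"
    using q by (intro integrable_on_lebesgue_on) (auto simp: f_def[abs_def] L2w_def)
  have f0: "0 \<le> f r" if "r \<in> {0<..<R}" for r
    using that wgt_pos[of r] by (auto simp: f_def)
  have I0: "I \<ge> 0" unfolding I_def by (rule integral_nonneg[OF fi f0])
  have "((\<lambda>r. (wgt m r * q r)\<^sup>2) \<longlongrightarrow> l\<^sup>2) (at_right 0)"
    by (intro tendsto_intros lim)
  moreover have "k < l\<^sup>2" using l by (simp add: k_def)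
  ultimately have "\<forall>\<^sub>F r in at_right 0. k < (wgt m r * q r)\<^sup>2"
    by (rule order_tendstoD)
  then obtain b where b: "b > 0" "\<And>r. 0 < r \<Longrightarrow> r < b \<Longrightarrow> k < (wgt m r * q r)\<^sup>2"
    unfolding eventually_at_right_field by blast
  define \<delta> where "\<delta> = Min {b, 1, R} / 2"
  have \<delta>: "0 < \<delta>" "\<delta> < b" "\<delta> < 1" "\<delta> < R" using b R by (auto simp: \<delta>_def min_def)
  have low: "k / r \<le> f r" if r: "0 < r" "r \<le> \<delta>" for r
  proof -
    have w: "0 < wgt m r" using r wgt_pos by auto
    have "wgt m r \<le> r powr m" using wgt_le r by auto
    also have "\<dots> \<le> r powr 1" using r \<delta> m by (intro powr_mono') auto
    finally have "wgt m r \<le> r" using r by simp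
    then have "k / r \<le> k / wgt m r"
      using k w by (intro divide_left_mono) auto
    also have "\<dots> \<le> (wgt m r * q r)\<^sup>2 / wgt m r"
      using b(2)[of r] r \<delta> w by (intro divide_right_mono) auto
    also have "\<dots> = f r" using w by (simp add: f_def power2_eq_square)
    finally show ?thesis .
  qed
  \<comment> \<open>Chosen so that \<open>k / r\<close> already has integral \<open>I + k\<close> over \<open>[x, \<delta>]\<close>.\<close>
  define x where "x = \<delta> * exp (- (I / k + 1))"
  have x: "0 < x" "x \<le> \<delta>"
    using \<delta> divide_nonneg_pos[OF I0 k] by (auto simp: x_def mult_le_cancel_left1)
  have hi: "((\<lambda>r. k / r) has_integral (k * ln \<delta> - k * ln x)) {x..\<delta>}"
    by (rule fundamental_theorem_of_calculus[OF x(2)])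
      (use x in \<open>auto intro!: derivative_eq_intros simp: has_real_derivative_iff_has_vector_derivative[symmetric]\<close>)
  have "k * ln \<delta> - k * ln x = integral {x..\<delta>} (\<lambda>r. k / r)"
    using hi by (simp add: integral_unique)
  also have "\<dots> \<le> integral {x..\<delta>} f"
  proof (rule integral_le)
    show "(\<lambda>r. k / r) integrable_on {x..\<delta>}" using hi by blast
    show "f integrable_on {x..\<delta>}"
      by (rule integrable_on_subinterval[OF fi]) (use x \<delta> in auto)
  qed (use low x in auto)
  also have "\<dots> \<le> I"
    unfolding I_def
    by (rule integral_subset_le[OF _ integrable_on_subinterval[OF fi] fi]) (use x \<delta> f0 in auto)
  finally have "k * ln \<delta> - k * ln x \<le> I" .
  moreover have "ln x = ln \<delta> - (I / k + 1)"
    using \<delta> by (simp add: x_def ln_mult)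
  ultimately have "k * (I / k + 1) \<le> I" by (simp add: algebra_simps)
  then show False using k by (simp add: distrib_left)
qed

section \<open>Weak form and uniqueness for the boundary value problem\<close>

text \<open>The parameter \<open>\<kappa>\<close> scales the inhomogeneity in the equation and in the boundary condition
  alike, so that differences of solutions are covered by \<open>\<kappa> = 0\<close>.  Square integrability of
  \<open>z\<close> and \<open>z'\<close> selects the regular branch at the origin.\<close>

definition regular_solution :: "real \<Rightarrow> (real \<Rightarrow> real) \<Rightarrow> (real \<Rightarrow> real) \<Rightarrow> bool" where
  "regular_solution \<kappa> z z' \<longleftrightarrow>
     z \<in> L2w m R \<and> z' \<in> L2w m R \<and> continuous_on {0<..R} z \<and> continuous_on {0<..R} z' \<and>
     (\<forall>r\<in>{0<..<R}. (z has_real_derivative z' r) (at r)) \<and>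
     (\<forall>r\<in>{0<..<R}. (z' has_real_derivative (r - m / r) * z' r + 2 * z r - \<kappa> / r) (at r)) \<and>
     m * z' R = R * z R - \<kappa>"

lemma regular_solution_weak_deriv:
  assumes "regular_solution \<kappa> z z'"
  shows "has_weak_deriv {0<..<R} z z'"
  using assms R unfolding regular_solution_def
  by (intro classical_imp_weak_deriv) (auto intro: continuous_on_subset)

text \<open>With \<open>q = z' - (T z - \<kappa>) / (m - 1)\<close> and \<open>h = z + r (T z - \<kappa>) / (m - 1)\<close> the
  equation says that \<open>(w q)' = w h\<close>.  Since \<open>w h\<close> is integrable, \<open>w q\<close> has a limit at the
  origin, which finite energy forces to be \<open>0\<close>; at \<open>R\<close> it vanishes by the boundary condition.
  Integration by parts gives \<open>E (\<phi> h) + E (d q) = 0\<close>, which is the claim rearranged.\<close>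

lemma regular_solution_weak_form:
  assumes z: "regular_solution \<kappa> z z'"
    and \<phi>: "\<phi> \<in> L2w m R" and d: "d \<in> L2w m R" and wd: "has_weak_deriv {0<..<R} \<phi> d"
  shows "Ex m R (\<lambda>r. z' r * d r) + Ex m R (\<lambda>r. z r * \<phi> r)
      + Ex m R (\<lambda>r. (r * z r - z' r) * (r * \<phi> r - d r)) / (m - 1)
    = \<kappa> * Ex m R (\<lambda>r. r * \<phi> r - d r) / (m - 1)"
proof -
  let ?S = "{0<..<R}"
  note zs = z[unfolded regular_solution_def]
  have zL: "z \<in> L2w m R" "z' \<in> L2w m R"
    and cz: "continuous_on {0<..R} z" "continuous_on {0<..R} z'"
    and Dz: "\<And>r. r \<in> ?S \<Longrightarrow> (z has_real_derivative z' r) (at r)"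
    and Dz': "\<And>r. r \<in> ?S \<Longrightarrow> (z' has_real_derivative (r - m / r) * z' r + 2 * z r - \<kappa> / r) (at r)"
    and bc: "m * z' R = R * z R - \<kappa>"
    using zs by auto
  define b where "b = inverse (m - 1)"
  have b: "b * (m - 1) = 1" using m by (simp add: b_def)
  define q where "q r = b * (m * z' r - r * z r + \<kappa>)" for r
  define h where "h r = z r + b * (r * (r * z r - z' r - \<kappa>))" for r
  define p where "p r = wgt m r * q r" for r
  define p' where "p' r = wgt m r * h r" for r
  have qL: "q \<in> L2w m R" and hL: "h \<in> L2w m R"
    unfolding q_def[abs_def] h_def[abs_def] by (intro L2w_intros zL)+
  have cp: "continuous_on {0<..R} p"
    unfolding p_def q_def by (intro continuous_intros cz continuous_on_subset[OF continuous_wgt]) auto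
  have cp': "continuous_on {0<..R} p'"
    unfolding p'_def h_def by (intro continuous_intros cz continuous_on_subset[OF continuous_wgt]) auto
  have Dp: "(p has_real_derivative p' r) (at r)" if r: "r \<in> ?S" for r
  proof -
    have r0: "r > 0" using r by simp
    have Dq: "(q has_real_derivative b * (m * ((r - m / r) * z' r + 2 * z r - \<kappa> / r) - (z r + r * z' r))) (at r)"
      unfolding q_def by (rule derivative_eq_intros Dz[OF r] Dz'[OF r] refl | simp)+
    have eq: "wgt m r * (m / r - r) * q r
        + b * (m * ((r - m / r) * z' r + 2 * z r - \<kappa> / r) - (z r + r * z' r)) * wgt m r = p' r"
    proof -
      have "(m / r - r) * (m * z' r - r * z r + \<kappa>)
          + (m * ((r - m / r) * z' r + 2 * z r - \<kappa> / r) - (z r + r * z' r))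
          = (m - 1) * z r + r * (r * z r - z' r - \<kappa>)"
        using r0 by (simp add: field_simps power2_eq_square)
      then have "wgt m r * b * ((m / r - r) * (m * z' r - r * z r + \<kappa>)
          + (m * ((r - m / r) * z' r + 2 * z r - \<kappa> / r) - (z r + r * z' r)))
          = wgt m r * ((b * (m - 1)) * z r + b * (r * (r * z r - z' r - \<kappa>)))"
        by (simp add: algebra_simps)
      then show ?thesis unfolding p'_def h_def q_def b by (simp add: algebra_simps)
    qed
    show ?thesis
      unfolding p_def by (rule DERIV_cong[OF DERIV_mult[OF has_real_derivative_wgt[OF r0] Dq] eq])
  qed
  have p'_int: "p' integrable_on {0..R}"
  proof -
    have "integrable (lebesgue_on ?S) (\<lambda>r. h r * wgt m r)"
      using L2w_integrable[OF hL] integrable_mu_iff[OF L2w_measurable[OF hL]] by simp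
    then have "(\<lambda>r. h r * wgt m r) integrable_on ?S"
      by (rule integrable_on_lebesgue_on) auto
    then show ?thesis
      by (simp add: integrable_on_open_interval_real p'_def[abs_def] mult.commute)
  qed
  have lim0: "(p \<longlongrightarrow> 0) (at_right 0)"
  proof -
    define c where "c = R / 2"
    have c: "0 < c" "c < R" using R by (auto simp: c_def)
    define l where "l = p c - integral {0..c} p'"
    have "continuous_on {0..c} (\<lambda>x. integral {x..c} p')"
      by (rule indefinite_integral_continuous_1'[OF integrable_subinterval_real[OF p'_int]]) (use c in auto)
    then have "((\<lambda>x. p c - integral {x..c} p') \<longlongrightarrow> l) (at 0 within {0..c})"
      unfolding l_def by (intro tendsto_intros) (use c in \<open>auto simp: continuous_on_def\<close>)
    then have "((\<lambda>x. p c - integral {x..c} p') \<longlongrightarrow> l) (at_right 0)"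
      using c by (simp add: at_within_Icc_at_right)
    moreover have "\<forall>\<^sub>F x in at_right 0. p c - integral {x..c} p' = p x"
      unfolding eventually_at_right_field
    proof (intro exI[of _ c] conjI allI impI c(1))
      fix x assume x: "0 < x" "x < c"
      have "(p' has_integral (p c - p x)) {x..c}"
      proof (rule fundamental_theorem_of_calculus)
        fix t assume "t \<in> {x..c}"
        then have "(p has_real_derivative p' t) (at t)" using x c by (intro Dp) auto
        then show "(p has_vector_derivative p' t) (at t within {x..c})"
          by (simp add: has_real_derivative_iff_has_vector_derivative has_vector_derivative_at_within)
      qed (use x in auto)
      then show "p c - integral {x..c} p' = p x" by (simp add: integral_unique)
    qed
    ultimately have "(p \<longlongrightarrow> l) (at_right 0)"
      by (rule Lim_transform_eventually)
    then show ?thesis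
      using wgt_L2w_limit_eq_0[OF qL, of l] by (simp add: p_def[abs_def])
  qed
  have limR: "(p \<longlongrightarrow> 0) (at_left R)"
  proof -
    have "p R = 0" using bc by (simp add: p_def q_def)
    moreover have "(p \<longlongrightarrow> p R) (at R within {0<..R})"
      using cp R by (auto simp: continuous_on_def)
    then have "(p \<longlongrightarrow> p R) (at R within {R/2..R})"
      by (rule tendsto_within_subset) (use R in auto)
    then have "(p \<longlongrightarrow> p R) (at_left R)" using R by (simp add: at_within_Icc_at_left)
    ultimately show ?thesis by simp
  qed
  have m1: "(\<lambda>r. \<phi> r * h r) \<in> borel_measurable (lebesgue_on ?S)" "(\<lambda>r. d r * q r) \<in> borel_measurable (lebesgue_on ?S)"
    by (intro borel_measurable_times L2w_measurable \<phi> d hL qL)+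
  have eq1: "(\<lambda>r. \<phi> r * h r * wgt m r) = (\<lambda>r. \<phi> r * p' r)" "(\<lambda>r. d r * q r * wgt m r) = (\<lambda>r. d r * p r)"
    by (auto simp: p_def p'_def)
  have i1: "integrable (lebesgue_on ?S) (\<lambda>r. \<phi> r * p' r)"
    using L2w_mult_integrable[OF \<phi> hL] integrable_mu_iff[OF m1(1)] eq1 by simp
  have i2: "integrable (lebesgue_on ?S) (\<lambda>r. d r * p r)"
    using L2w_mult_integrable[OF d qL] integrable_mu_iff[OF m1(2)] eq1 by simp
  have "(\<integral>r. \<phi> r * p' r \<partial>lebesgue_on ?S) = - (\<integral>r. d r * p r \<partial>lebesgue_on ?S)"
    by (rule weak_deriv_by_parts[OF R wd Dp _ lim0 limR i1 i2])
      (use cp' in \<open>auto intro: continuous_on_subset\<close>)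
  then have main: "Ex m R (\<lambda>r. \<phi> r * h r) + Ex m R (\<lambda>r. d r * q r) = 0"
    unfolding Ex_eq[OF m1(1)] Ex_eq[OF m1(2)] eq1 by simp
  define T\<^sub>z where "T\<^sub>z r = r * z r - z' r" for r
  define T\<^sub>\<phi> where "T\<^sub>\<phi> r = r * \<phi> r - d r" for r
  have TL: "T\<^sub>z \<in> L2w m R" "T\<^sub>\<phi> \<in> L2w m R"
    unfolding T\<^sub>z_def[abs_def] T\<^sub>\<phi>_def[abs_def] by (intro L2w_intros zL \<phi> d)+
  note ints = L2w_mult_integrable[OF zL(2) d] L2w_mult_integrable[OF zL(1) \<phi>]
    L2w_mult_integrable[OF TL] L2w_integrable[OF TL(2)]
  have pw: "\<phi> r * h r + d r * q r = z' r * d r + z r * \<phi> r + b * (T\<^sub>z r * T\<^sub>\<phi> r) - b * \<kappa> * T\<^sub>\<phi> r" for r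
  proof -
    have "q r = (b * (m - 1)) * z' r - b * (r * z r - z' r - \<kappa>)"
      unfolding q_def by (simp add: algebra_simps)
    then have q_eq: "q r = z' r - b * (r * z r - z' r - \<kappa>)" by (simp add: b)
    show ?thesis unfolding h_def T\<^sub>z_def T\<^sub>\<phi>_def q_eq by (simp add: algebra_simps)
  qed
  have "0 = Ex m R (\<lambda>r. \<phi> r * h r + d r * q r)"
    using main L2w_mult_integrable[OF \<phi> hL] L2w_mult_integrable[OF d qL] by (simp add: Ex_def)
  also have "\<dots> = Ex m R (\<lambda>r. z' r * d r) + Ex m R (\<lambda>r. z r * \<phi> r) + b * Ex m R (\<lambda>r. T\<^sub>z r * T\<^sub>\<phi> r)
      - b * \<kappa> * Ex m R T\<^sub>\<phi>"
    unfolding pw using ints by (simp add: Ex_def)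
  finally show ?thesis
    by (simp add: T\<^sub>z_def[abs_def] T\<^sub>\<phi>_def[abs_def] b_def field_simps)
qed

lemma continuous_AE_eq_0_imp:
  assumes ae: "AE r in lebesgue_on {0<..<R}. u r = 0" and cont: "continuous_on {0<..R} u"
    and r: "r \<in> {0<..R}"
  shows "u r = (0 :: real)"
proof -
  define a where "a = r / 2"
  have a: "0 < a" "a < r" "r \<le> R" using r by (auto simp: a_def)
  have ca: "continuous_on {a..R} (\<lambda>x. (u x)\<^sup>2)"
    using a by (intro continuous_intros continuous_on_subset[OF cont]) auto
  have "AE x in lebesgue. x \<in> {0<..<R} \<longrightarrow> u x = 0"
    using ae by (subst (asm) AE_restrict_space_iff) auto
  moreover have "AE x in lebesgue. x \<noteq> R"
    by (intro AE_completion AE_lborel_singleton)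
  ultimately have "AE x in lebesgue. x \<in> {a..R} \<longrightarrow> (u x)\<^sup>2 = 0"
    by eventually_elim (use a in auto)
  then have "AE x in lebesgue_on {a..R}. (u x)\<^sup>2 = 0"
    by (subst AE_restrict_space_iff) auto
  then have "(\<integral>x. (u x)\<^sup>2 \<partial>lebesgue_on {a..R}) = 0"
    by (rule integral_eq_zero_AE)
  then have "\<forall>x\<in>{a..R}. (u x)\<^sup>2 = 0"
    using a ca by (subst (asm) integralL_eq_0_iff) auto
  then show ?thesis using a by auto
qed

text \<open>Testing the weak form with the solution itself gives a sum of squares equal to zero.\<close>

lemma homogeneous_solution_eq_0:
  assumes u: "regular_solution 0 u u'" and r: "r \<in> {0<..R}"
  shows "u r = 0"
proof (rule continuous_AE_eq_0_imp[OF _ _ r])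
  have uL: "u \<in> L2w m R" "u' \<in> L2w m R" and cu: "continuous_on {0<..R} u"
    using u by (auto simp: regular_solution_def)
  show "continuous_on {0<..R} u" by (rule cu)
  have "Ex m R (\<lambda>r. (u' r)\<^sup>2) + Ex m R (\<lambda>r. (u r)\<^sup>2) + Ex m R (\<lambda>r. (r * u r - u' r)\<^sup>2) / (m - 1) = 0"
    using regular_solution_weak_form[OF u uL regular_solution_weak_deriv[OF u]]
    by (simp add: power2_eq_square)
  moreover have "0 \<le> Ex m R (\<lambda>r. (r * u r - u' r)\<^sup>2) / (m - 1)"
    using m by (intro divide_nonneg_pos Ex_square_nonneg) auto
  ultimately have "Ex m R (\<lambda>r. (u r)\<^sup>2) = 0"
    using Ex_square_nonneg[of u] Ex_square_nonneg[of u'] by linarith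
  then show "AE r in lebesgue_on {0<..<R}. u r = 0"
    by (rule Ex_square_eq_0_imp[OF uL(1)])
qed

lemma regular_solution_linear:
  assumes z: "regular_solution \<kappa> z z'" and y: "regular_solution \<mu> y y'"
  shows "regular_solution (a * \<kappa> + b * \<mu>) (\<lambda>r. a * z r + b * y r) (\<lambda>r. a * z' r + b * y' r)"
  unfolding regular_solution_def
proof (intro conjI ballI)
  note zs = z[unfolded regular_solution_def] and ys = y[unfolded regular_solution_def]
  show "(\<lambda>r. a * z r + b * y r) \<in> L2w m R" "(\<lambda>r. a * z' r + b * y' r) \<in> L2w m R"
    using zs ys by (auto intro!: L2w_intros)
  show "continuous_on {0<..R} (\<lambda>r. a * z r + b * y r)" "continuous_on {0<..R} (\<lambda>r. a * z' r + b * y' r)"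
    using zs ys by (auto intro!: continuous_intros)
  have "a * (m * z' R) + b * (m * y' R) = a * (R * z R - \<kappa>) + b * (R * y R - \<mu>)"
    using zs ys by simp
  then show "m * (a * z' R + b * y' R) = R * (a * z R + b * y R) - (a * \<kappa> + b * \<mu>)"
    by (simp add: algebra_simps)
  fix r assume r: "r \<in> {0<..<R}"
  have D: "(z has_real_derivative z' r) (at r)" "(y has_real_derivative y' r) (at r)"
    and D': "(z' has_real_derivative (r - m / r) * z' r + 2 * z r - \<kappa> / r) (at r)"
      "(y' has_real_derivative (r - m / r) * y' r + 2 * y r - \<mu> / r) (at r)"
    using zs ys r by auto
  show "((\<lambda>r. a * z r + b * y r) has_real_derivative a * z' r + b * y' r) (at r)"
    by (intro DERIV_add DERIV_cmult D)
  show "((\<lambda>r. a * z' r + b * y' r) has_real_derivative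
      (r - m / r) * (a * z' r + b * y' r) + 2 * (a * z r + b * y r) - (a * \<kappa> + b * \<mu>) / r) (at r)"
    by (rule DERIV_cong[OF DERIV_add[OF DERIV_cmult[OF D'(1)] DERIV_cmult[OF D'(2)]]])
      (simp add: algebra_simps add_divide_distrib)
qed

lemma regular_solution_unique:
  assumes "regular_solution \<kappa> z z'" "regular_solution \<kappa> y y'" "r \<in> {0<..R}"
  shows "z r = y r"
  using homogeneous_solution_eq_0[OF _ assms(3)] regular_solution_linear[OF assms(1,2), of 1 "-1"]
  by fastforce

section \<open>Explicit solution\<close>

text \<open>The left side of \<open>r z' + (m - 1 - r\<^sup>2) z = C - \<kappa> r\<close> has derivative
  \<open>r (z'' - (r - m / r) z' - 2 z)\<close>, so this first-order equation with arbitrary \<open>C\<close> is the once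
  integrated equation.  Multiplied by \<open>r\<close> to the power \<open>m - 2\<close> times \<open>exp (- r\<^sup>2 / 2)\<close> it reads
  \<open>(r powr (m - 1) * exp (- r\<^sup>2 / 2) * z)' = rhs C \<kappa> r\<close>.  Integrating from \<open>0\<close>, possible since
  \<open>m > 1\<close>, excludes the singular homogeneous solutions of order \<open>r powr (1 - m)\<close>.\<close>

definition rhs :: "real \<Rightarrow> real \<Rightarrow> real \<Rightarrow> real" where
  "rhs C \<kappa> t = t powr (m - 2) * exp (- t\<^sup>2 / 2) * (C - \<kappa> * t)"

definition sol :: "real \<Rightarrow> real \<Rightarrow> real \<Rightarrow> real" where
  "sol C \<kappa> r = r powr (1 - m) * exp (r\<^sup>2 / 2) * integral {0..r} (rhs C \<kappa>)"

definition sol_deriv :: "real \<Rightarrow> real \<Rightarrow> real \<Rightarrow> real" where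
  "sol_deriv C \<kappa> r = (C - \<kappa> * r - (m - 1 - r\<^sup>2) * sol C \<kappa> r) / r"

lemma abs_rhs_le:
  assumes "t \<in> {0..c}"
  shows "\<bar>rhs C \<kappa> t\<bar> \<le> (\<bar>C\<bar> + \<bar>\<kappa>\<bar> * c) * t powr (m - 2)"
proof -
  have "\<bar>C - \<kappa> * t\<bar> \<le> \<bar>C\<bar> + \<bar>\<kappa>\<bar> * \<bar>t\<bar>"
    using abs_triangle_ineq4[of C "\<kappa> * t"] by (simp add: abs_mult)
  also have "\<dots> \<le> \<bar>C\<bar> + \<bar>\<kappa>\<bar> * c"
    using assms by (intro add_left_mono mult_left_mono) auto
  finally have "exp (- t\<^sup>2 / 2) * \<bar>C - \<kappa> * t\<bar> \<le> 1 * (\<bar>C\<bar> + \<bar>\<kappa>\<bar> * c)"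
    by (intro mult_mono) auto
  then have "t powr (m - 2) * (exp (- t\<^sup>2 / 2) * \<bar>C - \<kappa> * t\<bar>) \<le> t powr (m - 2) * (\<bar>C\<bar> + \<bar>\<kappa>\<bar> * c)"
    by (intro mult_left_mono) auto
  then show ?thesis by (simp add: rhs_def abs_mult mult_ac)
qed

lemma rhs_integral:
  assumes c: "c \<ge> 0"
  shows "rhs C \<kappa> integrable_on {0..c}"
    "\<bar>integral {0..c} (rhs C \<kappa>)\<bar> \<le> (\<bar>C\<bar> + \<bar>\<kappa>\<bar> * c) * (c powr (m - 1) / (m - 1))"
proof -
  have hi: "((\<lambda>t. (\<bar>C\<bar> + \<bar>\<kappa>\<bar> * c) * t powr (m - 2)) has_integral
      (\<bar>C\<bar> + \<bar>\<kappa>\<bar> * c) * (c powr (m - 1) / (m - 1))) {0..c}"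
    using has_integral_mult_right[OF has_integral_powr_from_0[of "m - 2" c], of "\<bar>C\<bar> + \<bar>\<kappa>\<bar> * c"] m c
    by simp
  have "rhs C \<kappa> \<in> borel_measurable borel"
    unfolding rhs_def by measurable
  then have "rhs C \<kappa> \<in> borel_measurable (lebesgue_on {0..c})"
    by (intro measurable_restrict_space1 measurable_completion) simp
  then show i: "rhs C \<kappa> integrable_on {0..c}"
    by (rule measurable_bounded_by_integrable_imp_integrable_real
        [where g="\<lambda>t. (\<bar>C\<bar> + \<bar>\<kappa>\<bar> * c) * t powr (m - 2)"]) (use hi abs_rhs_le in auto)
  have "norm (integral {0..c} (rhs C \<kappa>)) \<le> integral {0..c} (\<lambda>t. (\<bar>C\<bar> + \<bar>\<kappa>\<bar> * c) * t powr (m - 2))"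
    by (rule integral_norm_bound_integral[OF i]) (use hi abs_rhs_le in auto)
  then show "\<bar>integral {0..c} (rhs C \<kappa>)\<bar> \<le> (\<bar>C\<bar> + \<bar>\<kappa>\<bar> * c) * (c powr (m - 1) / (m - 1))"
    using integral_unique[OF hi] by simp
qed

lemma integral_rhs_linear:
  assumes "c \<ge> 0"
  shows "integral {0..c} (rhs C \<kappa>) = C * integral {0..c} (rhs 1 0) + \<kappa> * integral {0..c} (rhs 0 1)"
proof -
  have eq: "rhs C \<kappa> = (\<lambda>t. C * rhs 1 0 t + \<kappa> * rhs 0 1 t)"
    by (simp add: fun_eq_iff rhs_def algebra_simps)
  have i: "(\<lambda>t. a * rhs b c' t) integrable_on {0..c}" for a b c'
    using integrable_on_cmult_left[OF rhs_integral(1)[OF assms, of b c'], of a] by simp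
  show ?thesis unfolding eq by (simp add: integral_add[OF i i])
qed

lemma has_real_derivative_integral_rhs:
  assumes r: "r > 0"
  shows "((\<lambda>r. integral {0..r} (rhs C \<kappa>)) has_real_derivative rhs C \<kappa> r) (at r)"
proof -
  have "((\<lambda>t. t powr (m - 2) * exp (- t\<^sup>2 / 2) * (C - \<kappa> * t)) \<longlongrightarrow> rhs C \<kappa> r) (at r)"
    unfolding rhs_def by (intro tendsto_intros) (use r in auto)
  then have "isCont (rhs C \<kappa>) r"
    by (simp add: isCont_def rhs_def[abs_def])
  then have "((\<lambda>r. integral {0..r} (rhs C \<kappa>)) has_vector_derivative rhs C \<kappa> r) (at r within {0..2 * r} - {})"
    by (intro integral_has_vector_derivative_continuous_at rhs_integral(1))
      (use r in \<open>auto intro: continuous_at_imp_continuous_at_within\<close>)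
  moreover have "at r within {0..2 * r} = at r"
    by (rule at_within_interior) (use r in auto)
  ultimately show ?thesis
    by (simp add: has_real_derivative_iff_has_vector_derivative)
qed

lemma has_real_derivative_sol:
  assumes r: "r > 0"
  shows "(sol C \<kappa> has_real_derivative sol_deriv C \<kappa> r) (at r)"
proof -
  define k where "k = r powr (1 - m) * exp (r\<^sup>2 / 2)"
  have "((\<lambda>r. exp (r\<^sup>2 / 2)) has_real_derivative exp (r\<^sup>2 / 2) * r) (at r)"
    by (auto intro!: derivative_eq_intros)
  from DERIV_mult'[OF has_real_derivative_powr[OF r, of "1 - m"] this]
  have "((\<lambda>r. r powr (1 - m) * exp (r\<^sup>2 / 2)) has_real_derivative
      r powr (1 - m) * (exp (r\<^sup>2 / 2) * r) + ((1 - m) * r powr (1 - m - 1)) * exp (r\<^sup>2 / 2)) (at r)" .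
  moreover have "r powr (1 - m - 1) = r powr (1 - m) / r"
    using r by (simp add: powr_diff powr_minus_divide)
  ultimately have Dk: "((\<lambda>r. r powr (1 - m) * exp (r\<^sup>2 / 2)) has_real_derivative k * ((1 - m) / r + r)) (at r)"
    by (simp add: k_def algebra_simps diff_divide_distrib)
  have "k * r powr (m - 2) * exp (- r\<^sup>2 / 2) = (r powr (1 - m) * r powr (m - 2)) * (exp (r\<^sup>2 / 2) * exp (- r\<^sup>2 / 2))"
    by (simp add: k_def)
  also have "\<dots> = 1 / r"
    using r by (simp add: powr_add[symmetric] exp_add[symmetric] powr_minus_divide)
  finally have kr: "k * rhs C \<kappa> r = (C - \<kappa> * r) / r"
    unfolding rhs_def by (metis (no_types, lifting) mult.assoc mult.commute mult.right_neutral times_divide_eq_right)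
  have "(sol C \<kappa> has_real_derivative
      k * ((1 - m) / r + r) * integral {0..r} (rhs C \<kappa>) + rhs C \<kappa> r * k) (at r)"
    unfolding sol_def[abs_def] k_def[symmetric]
    using DERIV_mult[OF Dk has_real_derivative_integral_rhs[OF r]] by (simp add: k_def)
  moreover have "k * ((1 - m) / r + r) * integral {0..r} (rhs C \<kappa>) + rhs C \<kappa> r * k = sol_deriv C \<kappa> r"
  proof -
    have "k * ((1 - m) / r + r) * integral {0..r} (rhs C \<kappa>) = ((1 - m) / r + r) * sol C \<kappa> r"
      by (simp add: sol_def k_def)
    moreover have "rhs C \<kappa> r * k = (C - \<kappa> * r) / r" using kr by (simp add: mult.commute)
    ultimately show ?thesis
      using r by (simp add: sol_deriv_def field_simps power2_eq_square)
  qed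
  ultimately show ?thesis by simp
qed

lemma has_real_derivative_sol_deriv:
  assumes r: "r > 0"
  shows "(sol_deriv C \<kappa> has_real_derivative
    (r - m / r) * sol_deriv C \<kappa> r + 2 * sol C \<kappa> r - \<kappa> / r) (at r)"
proof -
  let ?N = "\<lambda>r. C - \<kappa> * r - (m - 1 - r\<^sup>2) * sol C \<kappa> r"
  have DN: "(?N has_real_derivative
      - \<kappa> + 2 * r * sol C \<kappa> r - (m - 1 - r\<^sup>2) * sol_deriv C \<kappa> r) (at r)"
    by (rule derivative_eq_intros has_real_derivative_sol[OF r] refl | simp)+
  have "r \<noteq> 0" using r by simp
  note D = DERIV_divide[OF DN DERIV_ident this]
  have N: "?N r = r * sol_deriv C \<kappa> r" using r by (simp add: sol_deriv_def)
  show ?thesis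
    unfolding sol_deriv_def[abs_def]
    apply (rule DERIV_cong[OF D])
    unfolding N sol_deriv_def[symmetric]
    using r by (simp add: field_simps power2_eq_square)
qed

lemma continuous_sol: "continuous_on {0<..R} (sol C \<kappa>)" "continuous_on {0<..R} (sol_deriv C \<kappa>)"
  by (rule DERIV_continuous_on[OF has_field_derivative_at_within[OF has_real_derivative_sol]]
      DERIV_continuous_on[OF has_field_derivative_at_within[OF has_real_derivative_sol_deriv]]; simp)+

text \<open>Finite energy of the explicit solution needs only that its derivative is \<open>O(1 / r)\<close>, because
  \<open>w / r\<^sup>2\<close> is integrable at the origin for \<open>m > 1\<close>.\<close>

lemma L2w_inverse: "(\<lambda>r. 1 / r) \<in> L2w m R"
proof -
  have "((\<lambda>r. r powr (m - 2)) has_integral (R powr (m - 2 + 1) / (m - 2 + 1))) {0..R}"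
    by (rule has_integral_powr_from_0) (use m R in auto)
  then have "(\<lambda>r. r powr (m - 2)) integrable_on {0<..<R}"
    by (auto simp: integrable_on_open_interval_real)
  then have "(\<lambda>r. r powr (m - 2)) absolutely_integrable_on {0<..<R}"
    by (rule nonnegative_absolutely_integrable_1) auto
  then have g: "integrable (lebesgue_on {0<..<R}) (\<lambda>r. r powr (m - 2))"
    by (rule absolutely_integrable_imp_integrable) auto
  have ms: "(\<lambda>r. 1 / r) \<in> borel_measurable (lebesgue_on {0<..<R})"
    by (intro continuous_on_measurable continuous_intros) auto
  have "integrable (lebesgue_on {0<..<R}) (\<lambda>r. (1 / r)\<^sup>2 * wgt m r)"
  proof (rule measurable_bounded_by_integrable_imp_lebesgue_integrable[OF _ g])
    show "(\<lambda>r. (1 / r)\<^sup>2 * wgt m r) \<in> borel_measurable (lebesgue_on {0<..<R})"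
      by (intro borel_measurable_times borel_measurable_power ms wgt_measurable)
    fix r assume "r \<in> {0<..<R}"
    then have r: "r > 0" by simp
    have "(1 / r)\<^sup>2 * wgt m r \<le> (1 / r)\<^sup>2 * r powr m"
      by (intro mult_left_mono wgt_le r) auto
    also have "\<dots> = r powr (m - 2)"
      using r by (simp add: powr_diff power_one_over powr_numeral)
    finally show "norm ((1 / r)\<^sup>2 * wgt m r) \<le> r powr (m - 2)"
      using wgt_pos[OF r] by simp
  qed auto
  then show ?thesis using ms by (simp add: L2w_def)
qed

lemma sol_bounded:
  assumes r: "r \<in> {0<..<R}"
  shows "\<bar>sol C \<kappa> r\<bar> \<le> exp (R\<^sup>2 / 2) * ((\<bar>C\<bar> + \<bar>\<kappa>\<bar> * R) / (m - 1))"
proof -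
  have r0: "0 < r" "r < R" using r by auto
  have "\<bar>sol C \<kappa> r\<bar> = exp (r\<^sup>2 / 2) * (r powr (1 - m) * \<bar>integral {0..r} (rhs C \<kappa>)\<bar>)"
    by (simp add: sol_def abs_mult)
  also have "\<dots> \<le> exp (R\<^sup>2 / 2) * ((\<bar>C\<bar> + \<bar>\<kappa>\<bar> * R) / (m - 1))"
  proof (intro mult_mono)
    show "exp (r\<^sup>2 / 2) \<le> exp (R\<^sup>2 / 2)" using r0 by (simp add: power_mono)
    have "r powr (1 - m) * \<bar>integral {0..r} (rhs C \<kappa>)\<bar>
        \<le> r powr (1 - m) * ((\<bar>C\<bar> + \<bar>\<kappa>\<bar> * r) * (r powr (m - 1) / (m - 1)))"
      using r0 by (intro mult_left_mono rhs_integral(2)) auto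
    also have "\<dots> = (r powr (1 - m) * r powr (m - 1)) * ((\<bar>C\<bar> + \<bar>\<kappa>\<bar> * r) / (m - 1))"
      by simp
    also have "r powr (1 - m) * r powr (m - 1) = 1"
      using r0 by (simp add: powr_add[symmetric])
    also have "1 * ((\<bar>C\<bar> + \<bar>\<kappa>\<bar> * r) / (m - 1)) \<le> (\<bar>C\<bar> + \<bar>\<kappa>\<bar> * R) / (m - 1)"
      using r0 m by (simp add: divide_right_mono mult_left_mono)
    finally show "r powr (1 - m) * \<bar>integral {0..r} (rhs C \<kappa>)\<bar> \<le> (\<bar>C\<bar> + \<bar>\<kappa>\<bar> * R) / (m - 1)" .
  qed auto
  finally show ?thesis .
qed

lemma sol_L2w: "sol C \<kappa> \<in> L2w m R"
proof (rule L2w_bounded_mult[OF L2w_const[of 1]])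
  show "sol C \<kappa> \<in> borel_measurable (lebesgue_on {0<..<R})"
    by (rule continuous_on_measurable[OF continuous_on_subset[OF continuous_sol(1)]]) auto
qed (use sol_bounded in auto)

lemma sol_deriv_L2w: "sol_deriv C \<kappa> \<in> L2w m R"
proof -
  define B where "B = exp (R\<^sup>2 / 2) * ((\<bar>C\<bar> + \<bar>\<kappa>\<bar> * R) / (m - 1))"
  show ?thesis
  proof (rule L2w_bounded_mult[OF L2w_inverse])
    show "sol_deriv C \<kappa> \<in> borel_measurable (lebesgue_on {0<..<R})"
      by (rule continuous_on_measurable[OF continuous_on_subset[OF continuous_sol(2)]]) auto
    fix r assume r: "r \<in> {0<..<R}"
    have "\<bar>C - \<kappa> * r - (m - 1 - r\<^sup>2) * sol C \<kappa> r\<bar>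
        \<le> \<bar>C\<bar> + \<bar>\<kappa>\<bar> * \<bar>r\<bar> + \<bar>m - 1 - r\<^sup>2\<bar> * \<bar>sol C \<kappa> r\<bar>"
      unfolding abs_mult[symmetric] by linarith
    also have "\<dots> \<le> \<bar>C\<bar> + \<bar>\<kappa>\<bar> * R + (m - 1 + R\<^sup>2) * B"
    proof (intro add_mono mult_mono)
      have "r\<^sup>2 \<le> R\<^sup>2" using r by (intro power_mono) auto
      then show "\<bar>m - 1 - r\<^sup>2\<bar> \<le> m - 1 + R\<^sup>2"
        using m zero_le_power2[of r] by (simp add: abs_le_iff; linarith?)
      show "\<bar>sol C \<kappa> r\<bar> \<le> B" unfolding B_def by (rule sol_bounded[OF r])
    qed (use r m in auto)
    finally show "\<bar>sol_deriv C \<kappa> r\<bar> \<le> (\<bar>C\<bar> + \<bar>\<kappa>\<bar> * R + (m - 1 + R\<^sup>2) * B) * \<bar>1 / r\<bar>"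
      using r by (simp add: sol_deriv_def divide_right_mono)
  qed
qed

lemma regular_solution_sol_iff:
  "regular_solution \<kappa> (sol C \<kappa>) (sol_deriv C \<kappa>) \<longleftrightarrow> m * sol_deriv C \<kappa> R = R * sol C \<kappa> R - \<kappa>"
  unfolding regular_solution_def
  using sol_L2w sol_deriv_L2w continuous_sol has_real_derivative_sol has_real_derivative_sol_deriv by auto

text \<open>The boundary condition is \<open>C \<alpha> + \<kappa> \<beta> = 0\<close>.  If \<open>\<alpha>\<close> vanished, the member with \<open>C = 1\<close> and
  \<open>\<kappa> = 0\<close> would be a homogeneous solution, hence zero at \<open>R\<close>; its boundary condition would
  then say \<open>m / R = 0\<close>.\<close>

lemma regular_solution_exists: "\<exists>C. regular_solution \<kappa> (sol C \<kappa>) (sol_deriv C \<kappa>)"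
proof -
  define k where "k = R powr (1 - m) * exp (R\<^sup>2 / 2)"
  define I\<^sub>0 where "I\<^sub>0 = integral {0..R} (rhs 1 0)"
  define I\<^sub>1 where "I\<^sub>1 = integral {0..R} (rhs 0 1)"
  have solR: "sol C \<kappa> R = k * (C * I\<^sub>0 + \<kappa> * I\<^sub>1)" for C \<kappa>
    using integral_rhs_linear[of R C \<kappa>] R by (simp add: sol_def k_def I\<^sub>0_def I\<^sub>1_def)
  define \<alpha> where "\<alpha> = m * ((1 - (m - 1 - R\<^sup>2) * (k * I\<^sub>0)) / R) - R * (k * I\<^sub>0)"
  define \<beta> where "\<beta> = m * ((- R - (m - 1 - R\<^sup>2) * (k * I\<^sub>1)) / R) - R * (k * I\<^sub>1) + 1"
  have bc: "m * sol_deriv C \<kappa> R - (R * sol C \<kappa> R - \<kappa>) = C * \<alpha> + \<kappa> * \<beta>" for C \<kappa>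
    unfolding sol_deriv_def solR \<alpha>_def \<beta>_def using R by (simp add: field_simps)
  have "\<alpha> \<noteq> 0"
  proof
    assume "\<alpha> = 0"
    then have "m * sol_deriv 1 0 R - (R * sol 1 0 R - 0) = 0" unfolding bc by simp
    then have bc0: "m * sol_deriv 1 0 R = R * sol 1 0 R - 0" by simp
    then have "regular_solution 0 (sol 1 0) (sol_deriv 1 0)"
      by (simp add: regular_solution_sol_iff)
    then have "sol 1 0 R = 0" by (rule homogeneous_solution_eq_0) (use R in auto)
    then show False using bc0 m R by (simp add: sol_deriv_def)
  qed
  then have "m * sol_deriv (- \<kappa> * \<beta> / \<alpha>) \<kappa> R - (R * sol (- \<kappa> * \<beta> / \<alpha>) \<kappa> R - \<kappa>) = 0"
    unfolding bc by simp
  then show ?thesis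
    by (intro exI[of _ "- \<kappa> * \<beta> / \<alpha>"]) (simp add: regular_solution_sol_iff)
qed

section \<open>Sobolev functions and the boundary value problem\<close>


lemma H1w_D:
  assumes v: "v \<in> H1w m R"
  shows "v \<in> L2w m R" "wd R v \<in> L2w m R" "has_weak_deriv {0<..<R} v (wd R v)"
proof -
  show w: "has_weak_deriv {0<..<R} v (wd R v)"
    using v by (auto simp: H1w_def H1_loc_def intro: has_weak_deriv_weak_deriv)
  have vm: "v \<in> borel_measurable (lebesgue_on {0<..<R})"
    using v by (auto simp: H1w_def H1_loc_def locally_square_integrable_def)
  have dm: "wd R v \<in> borel_measurable (lebesgue_on {0<..<R})"
    using w by (intro locally_integrable_measurable) (auto simp: has_weak_deriv_def)
  have i: "integrable (lebesgue_on {0<..<R}) (\<lambda>r. ((v r)\<^sup>2 + (wd R v r)\<^sup>2) * wgt m r)"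
    using v by (auto simp: H1w_def)
  have "integrable (lebesgue_on {0<..<R}) (\<lambda>r. (f r)\<^sup>2 * wgt m r)"
    if f: "f \<in> borel_measurable (lebesgue_on {0<..<R})" "\<And>r. (f r)\<^sup>2 \<le> (v r)\<^sup>2 + (wd R v r)\<^sup>2" for f
  proof (rule measurable_bounded_by_integrable_imp_lebesgue_integrable[OF _ i])
    show "(\<lambda>r. (f r)\<^sup>2 * wgt m r) \<in> borel_measurable (lebesgue_on {0<..<R})"
      by (intro borel_measurable_times borel_measurable_power f wgt_measurable)
    show "norm ((f r)\<^sup>2 * wgt m r) \<le> ((v r)\<^sup>2 + (wd R v r)\<^sup>2) * wgt m r" if "r \<in> {0<..<R}" for r
      using f(2)[of r] wgt_pos[of r] that by (simp add: abs_mult mult_right_mono)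
  qed auto
  then show "v \<in> L2w m R" "wd R v \<in> L2w m R"
    using vm dm by (auto simp: L2w_def)
qed

lemma T_L2w: "v \<in> H1w m R \<Longrightarrow> T R v \<in> L2w m R"
  unfolding T_def[abs_def] by (intro L2w_intros H1w_D)

lemma L2w_cong_AE:
  assumes "f \<in> L2w m R" "g \<in> borel_measurable (lebesgue_on {0<..<R})" "AE r in lebesgue_on {0<..<R}. f r = g r"
  shows "g \<in> L2w m R"
  unfolding L2w_iff
proof (intro conjI assms(2))
  show "integrable (mu m R) (\<lambda>r. (g r)\<^sup>2)"
  proof (rule integrable_cong_AE_imp)
    show "integrable (mu m R) (\<lambda>r. (f r)\<^sup>2)" using assms(1) by (simp add: L2w_iff)
    show "(\<lambda>r. (g r)\<^sup>2) \<in> borel_measurable (mu m R)" using assms(2) by (simp add: measurable_mu)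
    show "AE r in mu m R. (f r)\<^sup>2 = (g r)\<^sup>2"
      unfolding AE_mu_iff using assms(3) by eventually_elim simp
  qed
qed

lemma classical_H1w:
  assumes L: "v \<in> L2w m R" "v' \<in> L2w m R"
    and D: "\<And>r. r \<in> {0<..<R} \<Longrightarrow> (v has_real_derivative v' r) (at r)"
    and c: "continuous_on {0<..<R} v'"
  shows "v \<in> H1w m R" "AE r in lebesgue_on {0<..<R}. wd R v r = v' r"
proof -
  have cv: "continuous_on {0<..<R} v"
    by (rule DERIV_continuous_on[OF has_field_derivative_at_within[OF D]])
  have w: "has_weak_deriv {0<..<R} v v'"
    by (rule classical_imp_weak_deriv[OF R D c])
  have w': "has_weak_deriv {0<..<R} v (wd R v)"
    by (rule has_weak_deriv_weak_deriv[OF w])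
  show ae: "AE r in lebesgue_on {0<..<R}. wd R v r = v' r"
    by (rule weak_deriv_unique_AE[OF R w' w])
  have "AE r in lebesgue_on {0<..<R}. v' r = wd R v r"
    using ae by eventually_elim simp
  then have wL: "wd R v \<in> L2w m R"
    using w' by (intro L2w_cong_AE[OF L(2)] locally_integrable_measurable) (auto simp: has_weak_deriv_def)
  have lsq: "locally_square_integrable {0<..<R} f" if "continuous_on {0<..<R} f" for f :: "real \<Rightarrow> real"
  proof -
    have "continuous_on {0<..<R} (\<lambda>x. (f x)\<^sup>2)" using that by (intro continuous_intros)
    from continuous_imp_locally_integrable[OF this] continuous_on_measurable[OF that]
    show ?thesis by (simp add: locally_square_integrable_def locally_integrable_def)
  qed
  have "integrable (lebesgue_on {0<..<R}) (\<lambda>r. (v r)\<^sup>2 * wgt m r + (wd R v r)\<^sup>2 * wgt m r)"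
    using L(1) wL by (intro Bochner_Integration.integrable_add) (auto simp: L2w_def)
  then have "integrable (lebesgue_on {0<..<R}) (\<lambda>r. ((v r)\<^sup>2 + (wd R v r)\<^sup>2) * wgt m r)"
    by (simp add: distrib_right)
  then show "v \<in> H1w m R"
    using w lsq[OF cv] lsq[OF c] by (auto simp: H1w_def H1_loc_def)
qed

lemma bvp_solution_regular:
  assumes z: "bvp_solution m R z"
  obtains z' where "regular_solution 1 z z'" "AE r in lebesgue_on {0<..<R}. wd R z r = z' r"
    "\<And>r. r \<in> {0<..<R} \<Longrightarrow> deriv z r = z' r"
proof -
  obtain z' z'' where zH: "z \<in> H1w m R"
    and Dz: "\<And>r. r \<in> {0<..R} \<Longrightarrow> (z has_real_derivative z' r) (at r within {0<..R})"
    and c: "continuous_on {0<..R} z'"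
    and D': "\<And>r. r \<in> {0<..<R} \<Longrightarrow> (z' has_real_derivative z'' r) (at r)"
    and ode: "\<And>r. r \<in> {0<..<R} \<Longrightarrow> - z'' r + (r - m / r) * z' r + 2 * z r = 1 / r"
    and bc: "m * z' R = R * z R - 1"
    using z unfolding bvp_solution_def by blast
  have cz: "continuous_on {0<..R} z" by (rule DERIV_continuous_on[OF Dz])
  have c': "continuous_on {0<..<R} z'" by (rule continuous_on_subset[OF c]) auto
  have D: "(z has_real_derivative z' r) (at r)" if r: "r \<in> {0<..<R}" for r
  proof -
    have "at r within {0<..R} = at r"
      using r by (intro at_within_open_subset[of r "{0<..<R}"]) auto
    then show ?thesis using Dz[of r] r by simp
  qed
  note zL = H1w_D[OF zH]
  have ae: "AE r in lebesgue_on {0<..<R}. wd R z r = z' r"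
    by (rule weak_deriv_unique_AE[OF R zL(3) classical_imp_weak_deriv[OF R D c']])
  have z'L: "z' \<in> L2w m R"
    by (rule L2w_cong_AE[OF zL(2) continuous_on_measurable[OF c'] ae])
  have "z'' r = (r - m / r) * z' r + 2 * z r - 1 / r" if "r \<in> {0<..<R}" for r
    using ode[OF that] by simp
  then have "regular_solution 1 z z'"
    using zL(1) z'L cz c D D' bc by (simp add: regular_solution_def)
  moreover have "deriv z r = z' r" if "r \<in> {0<..<R}" for r
    by (rule DERIV_imp_deriv[OF D[OF that]])
  ultimately show ?thesis using that ae by blast
qed

lemma bvp_solution_exists: "\<exists>z. bvp_solution m R z"
proof -
  obtain C where C: "regular_solution 1 (sol C 1) (sol_deriv C 1)"
    using regular_solution_exists by blast
  have "sol C 1 \<in> H1w m R"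
    by (rule classical_H1w(1)[OF sol_L2w sol_deriv_L2w has_real_derivative_sol
          continuous_on_subset[OF continuous_sol(2)]]) auto
  moreover have "(sol C 1 has_real_derivative sol_deriv C 1 r) (at r within {0<..R})" if "r \<in> {0<..R}" for r
    by (rule has_field_derivative_at_within[OF has_real_derivative_sol]) (use that in auto)
  moreover have "(sol_deriv C 1 has_real_derivative
      (r - m / r) * sol_deriv C 1 r + 2 * sol C 1 r - 1 / r) (at r)" if "r \<in> {0<..<R}" for r
    using that by (intro has_real_derivative_sol_deriv) auto
  moreover have "m * sol_deriv C 1 R = R * sol C 1 R - 1"
    using C by (simp add: regular_solution_def)
  ultimately have "bvp_solution m R (sol C 1)"
    unfolding bvp_solution_def using continuous_sol(2)
    by (intro conjI exI[of _ "sol_deriv C 1"]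
        exI[of _ "\<lambda>r. (r - m / r) * sol_deriv C 1 r + 2 * sol C 1 r - 1 / r"] ballI) simp_all
  then show ?thesis by blast
qed

lemma bvp_solution_unique:
  assumes "bvp_solution m R y" "bvp_solution m R z" "r \<in> {0<..R}"
  shows "y r = z r"
proof -
  obtain y' where y': "regular_solution 1 y y'" by (rule bvp_solution_regular[OF assms(1)])
  obtain z' where z': "regular_solution 1 z z'" by (rule bvp_solution_regular[OF assms(2)])
  show ?thesis by (rule regular_solution_unique[OF y' z' assms(3)])
qed

lemma bvp_solution_weak_form:
  assumes z: "bvp_solution m R z" and v: "v \<in> H1w m R"
  shows "Ex m R (\<lambda>r. wd R v r * wd R z r) + Ex m R (\<lambda>r. v r * z r)
      + Ex m R (\<lambda>r. T R v r * T R z r) / (m - 1) = Ex m R (T R v) / (m - 1)"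
proof -
  obtain z' where z': "regular_solution 1 z z'" and ae: "AE r in lebesgue_on {0<..<R}. wd R z r = z' r"
    by (rule bvp_solution_regular[OF z])
  have zH: "z \<in> H1w m R" using z by (simp add: bvp_solution_def)
  note vL = H1w_D[OF v] and zL = H1w_D[OF zH]
  have z'm: "z' \<in> L2w m R" using z' by (simp add: regular_solution_def)
  have "Ex m R (\<lambda>r. wd R v r * wd R z r) = Ex m R (\<lambda>r. z' r * wd R v r)"
  proof (rule Ex_cong_AE)
    show "AE r in lebesgue_on {0<..<R}. wd R v r * wd R z r = z' r * wd R v r"
      using ae by eventually_elim simp
    show "(\<lambda>r. wd R v r * wd R z r) \<in> borel_measurable (lebesgue_on {0<..<R})"
      "(\<lambda>r. z' r * wd R v r) \<in> borel_measurable (lebesgue_on {0<..<R})"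
      by (intro borel_measurable_times[OF L2w_measurable L2w_measurable] vL zL z'm)+
  qed
  moreover have "Ex m R (\<lambda>r. T R v r * T R z r) = Ex m R (\<lambda>r. (r * z r - z' r) * (r * v r - wd R v r))"
  proof (rule Ex_cong_AE)
    show "AE r in lebesgue_on {0<..<R}. T R v r * T R z r = (r * z r - z' r) * (r * v r - wd R v r)"
      using ae by eventually_elim (simp add: T_def)
    show "(\<lambda>r. T R v r * T R z r) \<in> borel_measurable (lebesgue_on {0<..<R})"
      by (intro borel_measurable_times L2w_measurable T_L2w v zH)
    show "(\<lambda>r. (r * z r - z' r) * (r * v r - wd R v r)) \<in> borel_measurable (lebesgue_on {0<..<R})"
      by (intro borel_measurable_times[OF L2w_measurable L2w_measurable] L2w_intros z'm vL zL)
  qed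
  ultimately show ?thesis
    using regular_solution_weak_form[OF z' vL]
    by (simp add: T_def[abs_def] mult.commute[of "v _"])
qed

section \<open>The saddle point\<close>

text \<open>For fixed \<open>v\<close> this is the square completed in \<open>g\<close>: the maximizer is
  \<open>1 + (T v - E (T v)) / (m - 1)\<close> and the maximum is \<open>J v\<close>.\<close>

lemma J_minus_Phi:
  assumes v: "v \<in> H1w m R" and g: "g \<in> L2w m R" and g1: "Ex m R g = 1"
  shows "J m R v - Phi m R g v = (m - 1) / m *
    Ex m R (\<lambda>r. (g r + - (1 / (m - 1)) * T R v r + (Ex m R (T R v) / (m - 1) - 1))\<^sup>2)"
proof -
  note vL = H1w_D[OF v] and tL = T_L2w[OF v]
  define A where "A = Ex m R (\<lambda>r. (wd R v r)\<^sup>2 + (v r)\<^sup>2)"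
  have iA: "integrable (mu m R) (\<lambda>r. (wd R v r)\<^sup>2 + (v r)\<^sup>2)"
    using vL by (auto simp: L2w_iff)
  have iB: "integrable (mu m R) (\<lambda>r. (g r + T R v r)\<^sup>2 / m)"
    using L2w_add[OF g tL] by (auto simp: L2w_iff)
  have "Phi m R g v = A + Ex m R (\<lambda>r. (g r + T R v r)\<^sup>2) / m - Var m R g"
    using Bochner_Integration.integral_add[OF iA iB] by (simp add: Phi_def A_def Ex_def)
  moreover have "J m R v = A + Var m R (T R v) / (m - 1) + (1 + Ex m R (T R v))\<^sup>2 / m"
    by (simp add: J_def A_def)
  moreover have "A + (\<Theta> - \<tau>\<^sup>2) / (m - 1) + (1 + \<tau>)\<^sup>2 / m - (A + (G + 2 * X + \<Theta>) / m - (G - 1))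
      = (m - 1) / m * (G + (- (1 / (m - 1)))\<^sup>2 * \<Theta> + (\<tau> / (m - 1) - 1)\<^sup>2 + 2 * (- (1 / (m - 1))) * X
        + 2 * (\<tau> / (m - 1) - 1) * 1 + 2 * (- (1 / (m - 1))) * (\<tau> / (m - 1) - 1) * \<tau>)" for G X \<Theta> \<tau> :: real
  proof -
    define n where "n = m - 1"
    have n: "n > 0" "m - 1 = n" "m = n + 1" using m by (auto simp: n_def)
    show ?thesis unfolding n(2) unfolding n(3) using n(1)
      by (simp add: divide_simps) (simp add: algebra_simps power2_eq_square)
  qed
  moreover have "Ex m R (\<lambda>r. (g r + T R v r)\<^sup>2)
      = Ex m R (\<lambda>r. (g r)\<^sup>2) + 2 * Ex m R (\<lambda>r. g r * T R v r) + Ex m R (\<lambda>r. (T R v r)\<^sup>2)"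
    using Ex_square_expand[OF g tL, of 1 0] by simp
  ultimately show ?thesis
    unfolding Ex_square_expand[OF g tL] by (simp only: g1 Var_eq[OF g] Var_eq[OF tL] power_one)
qed

end

locale gaussian_bvp = gaussian_interval +
  fixes z :: "real \<Rightarrow> real"
  assumes z: "bvp_solution m R z"
begin

abbreviation "H \<equiv> Hm m R z"
abbreviation "c \<equiv> cm m R z"

definition v_opt :: "real \<Rightarrow> real" where "v_opt r = - c * z r"
definition g_opt :: "real \<Rightarrow> real" where "g_opt r = (m - T R z r) / (m - H)"

lemma z_H1w: "z \<in> H1w m R"
  using z by (simp add: bvp_solution_def)

lemma z_energy:
  "(m - 1) * (Ex m R (\<lambda>r. (wd R z r)\<^sup>2) + Ex m R (\<lambda>r. (z r)\<^sup>2)) + Ex m R (\<lambda>r. (T R z r)\<^sup>2) = H"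
  using bvp_solution_weak_form[OF z z_H1w] m by (simp add: Hm_def power2_eq_square field_simps)

text \<open>Jensen and the energy identity give \<open>H\<^sup>2 \<le> E (T z)\<^sup>2 \<le> H\<close>.\<close>

lemma H_less: "H < m"
proof -
  have "0 \<le> Var m R (T R z)" unfolding Var_def by (rule Ex_square_nonneg)
  then have "H\<^sup>2 \<le> Ex m R (\<lambda>r. (T R z r)\<^sup>2)"
    by (simp add: Var_eq[OF T_L2w[OF z_H1w]] Hm_def)
  also have "\<dots> \<le> H"
    using z_energy m Ex_square_nonneg[of "wd R z"] Ex_square_nonneg[of z]
      mult_nonneg_nonneg[of "m - 1" "Ex m R (\<lambda>r. (wd R z r)\<^sup>2) + Ex m R (\<lambda>r. (z r)\<^sup>2)"] by linarith
  finally have "H * (H - 1) \<le> 0" by (simp add: power2_eq_square algebra_simps)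
  then have "H \<le> 1" by (smt (verit) mult_pos_pos)
  then show ?thesis using m by linarith
qed

lemma v_opt: "v_opt \<in> H1w m R" "AE r in lebesgue_on {0<..<R}. T R v_opt r = - c * T R z r"
  "AE r in lebesgue_on {0<..<R}. wd R v_opt r = - c * wd R z r"
proof -
  obtain z' where z': "regular_solution 1 z z'" and ae: "AE r in lebesgue_on {0<..<R}. wd R z r = z' r"
    by (rule bvp_solution_regular[OF z])
  note zs = z'[unfolded regular_solution_def]
  have L: "v_opt \<in> L2w m R" "(\<lambda>r. - c * z' r) \<in> L2w m R"
    unfolding v_opt_def[abs_def] by (rule L2w_cmult; use zs in blast)+
  have D: "(v_opt has_real_derivative - c * z' r) (at r)" if "r \<in> {0<..<R}" for r
    unfolding v_opt_def[abs_def] by (rule DERIV_cmult) (use zs that in blast)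
  have ct: "continuous_on {0<..<R} (\<lambda>r. - c * z' r)"
  proof -
    have "continuous_on {0<..R} z'" using zs by blast
    then have "continuous_on {0<..<R} z'" by (rule continuous_on_subset) auto
    then show ?thesis by (intro continuous_intros)
  qed
  show "v_opt \<in> H1w m R" by (rule classical_H1w(1)[OF L D ct])
  have v': "AE r in lebesgue_on {0<..<R}. wd R v_opt r = - c * z' r"
    by (rule classical_H1w(2)[OF L D ct])
  show ae': "AE r in lebesgue_on {0<..<R}. wd R v_opt r = - c * wd R z r"
    using v' ae by eventually_elim simp
  then show "AE r in lebesgue_on {0<..<R}. T R v_opt r = - c * T R z r"
    by eventually_elim (simp add: T_def v_opt_def algebra_simps)
qed

lemma g_opt: "g_opt \<in> L2w m R" "Ex m R g_opt = 1"
proof -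
  have eq: "g_opt = (\<lambda>r. - (1 / (m - H)) * T R z r + m / (m - H))"
    by (simp add: g_opt_def fun_eq_iff diff_divide_distrib)
  show "g_opt \<in> L2w m R" unfolding eq by (intro L2w_intros T_L2w z_H1w)
  have "Ex m R g_opt = - (1 / (m - H)) * H + m / (m - H)"
    unfolding eq by (subst Ex_add[OF L2w_cmult[OF T_L2w[OF z_H1w]] L2w_const])
      (simp only: Ex_cmult Ex_const Hm_def)
  also have "\<dots> = (m - H) / (m - H)" by (simp only: diff_divide_distrib minus_divide_left) simp
  also have "\<dots> = 1" using H_less by simp
  finally show "Ex m R g_opt = 1" .
qed

text \<open>The square completed in \<open>v\<close> at \<open>g_opt\<close>: the terms linear in \<open>v\<close> cancel by the weak form, since
  \<open>(g_opt - c T z) / m = (1 - T z) / (m - H)\<close>.\<close>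

lemma Phi_g_opt:
  assumes v: "v \<in> H1w m R"
  shows "Phi m R g_opt v = 1 - c + Ex m R (\<lambda>r. (wd R v r + c * wd R z r)\<^sup>2)
    + Ex m R (\<lambda>r. (v r + c * z r)\<^sup>2) + Ex m R (\<lambda>r. (T R v r + c * T R z r)\<^sup>2) / m"
proof -
  note vL = H1w_D[OF v] and zL = H1w_D[OF z_H1w] and tL = T_L2w[OF v] and sL = T_L2w[OF z_H1w]
  define N where "N = m - H"
  have N: "N > 0" using H_less by (simp add: N_def)
  define P where "P = Ex m R (\<lambda>r. (wd R z r)\<^sup>2) + Ex m R (\<lambda>r. (z r)\<^sup>2)"
  define A where "A = Ex m R (\<lambda>r. (wd R v r)\<^sup>2) + Ex m R (\<lambda>r. (v r)\<^sup>2)"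
  define B where "B = Ex m R (\<lambda>r. wd R v r * wd R z r) + Ex m R (\<lambda>r. v r * z r)"
  define S where "S = Ex m R (\<lambda>r. (T R z r)\<^sup>2)"
  define X where "X = Ex m R (\<lambda>r. T R v r * T R z r)"
  define Q where "Q = Ex m R (\<lambda>r. (T R v r)\<^sup>2)"
  define \<tau> where "\<tau> = Ex m R (T R v)"
  have wz: "(m - 1) * P = H - S" using z_energy by (simp add: P_def S_def)
  have wv: "(m - 1) * B = \<tau> - X"
    using bvp_solution_weak_form[OF z v] m by (simp add: B_def X_def \<tau>_def field_simps)
  have c: "c = (m - 1) / N" by (simp add: cm_def N_def)
  have iA: "integrable (mu m R) (\<lambda>r. (wd R v r)\<^sup>2)" "integrable (mu m R) (\<lambda>r. (v r)\<^sup>2)"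
    using vL by (auto simp: L2w_iff)
  have iB: "integrable (mu m R) (\<lambda>r. (g_opt r + T R v r)\<^sup>2 / m)"
    using L2w_add[OF g_opt(1) tL] by (auto simp: L2w_iff)
  have eq: "(\<lambda>r. (g_opt r + T R v r)\<^sup>2) = (\<lambda>r. (T R v r + - (1 / N) * T R z r + m / N)\<^sup>2)"
    by (simp add: fun_eq_iff g_opt_def N_def diff_divide_distrib algebra_simps)
  have eq2: "(\<lambda>r. (g_opt r)\<^sup>2) = (\<lambda>r. (0 + - (1 / N) * T R z r + m / N)\<^sup>2)"
    by (simp add: fun_eq_iff g_opt_def N_def diff_divide_distrib algebra_simps)
  have V: "Var m R g_opt = (S + m\<^sup>2 - 2 * m * H) / N\<^sup>2 - 1"
    unfolding Var_eq[OF g_opt(1)] g_opt(2) eq2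
    unfolding Ex_square_expand[OF L2w_const sL] using N
    by (simp add: Ex_const S_def Hm_def field_simps power2_eq_square)
  have "Phi m R g_opt v = A + Ex m R (\<lambda>r. (g_opt r + T R v r)\<^sup>2) / m - Var m R g_opt"
    unfolding Phi_def A_def using iA iB by (simp add: Ex_def)
  also have "Ex m R (\<lambda>r. (g_opt r + T R v r)\<^sup>2)
      = Q + S / N\<^sup>2 + (m / N)\<^sup>2 - 2 / N * X + 2 * (m / N) * \<tau> - 2 * m * H / N\<^sup>2"
    unfolding eq Ex_square_expand[OF tL sL] using N
    by (simp add: Q_def S_def X_def \<tau>_def Hm_def power2_eq_square)
  finally have Phi: "Phi m R g_opt v = A
      + (Q + S / N\<^sup>2 + (m / N)\<^sup>2 - 2 / N * X + 2 * (m / N) * \<tau> - 2 * m * H / N\<^sup>2) / m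
      - ((S + m\<^sup>2 - 2 * m * H) / N\<^sup>2 - 1)"
    unfolding V .
  have s: "Ex m R (\<lambda>r. (wd R v r + c * wd R z r)\<^sup>2) + Ex m R (\<lambda>r. (v r + c * z r)\<^sup>2)
      = A + 2 * c * B + c\<^sup>2 * P"
    using Ex_square_expand[OF vL(2) zL(2), of c 0] Ex_square_expand[OF vL(1) zL(1), of c 0]
    by (simp add: A_def B_def P_def algebra_simps)
  have t: "Ex m R (\<lambda>r. (T R v r + c * T R z r)\<^sup>2) = Q + 2 * c * X + c\<^sup>2 * S"
    using Ex_square_expand[OF tL sL, of c 0] by (simp add: Q_def S_def X_def)
  have cB: "c * B = (\<tau> - X) / N" using wv N by (simp add: c field_simps)
  have "c\<^sup>2 * P = (m - 1) * ((m - 1) * P) / N\<^sup>2" by (simp add: c power2_eq_square)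
  then have cP: "c\<^sup>2 * P = (m - 1) * (H - S) / N\<^sup>2" by (simp add: wz)
  have H: "H = m - N" by (simp add: N_def)
  have "1 - c + (A + 2 * c * B + c\<^sup>2 * P) + (Q + 2 * c * X + c\<^sup>2 * S) / m
      = 1 - c + (A + 2 * (c * B) + c\<^sup>2 * P) + (Q + 2 * c * X + c\<^sup>2 * S) / m" by simp
  also have "\<dots> = Phi m R g_opt v"
    unfolding cB cP Phi unfolding c H using N m by (simp add: field_simps power2_eq_square)
  finally show ?thesis using s t by simp
qed

text \<open>The maximizer in \<open>J_minus_Phi\<close> for \<open>v = v_opt\<close> is \<open>g_opt\<close>.\<close>

lemma Phi_v_opt:
  assumes g: "g \<in> L2w m R" "Ex m R g = 1"
  shows "Phi m R g v_opt = J m R v_opt - (m - 1) / m * Ex m R (\<lambda>r. (g r - g_opt r)\<^sup>2)"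
proof -
  note tL = T_L2w[OF v_opt(1)]
  have "Ex m R (T R v_opt) = Ex m R (\<lambda>r. - c * T R z r)"
    by (rule Ex_cong_AE[OF v_opt(2)]) (intro L2w_measurable tL L2w_cmult T_L2w z_H1w)+
  then have E: "Ex m R (T R v_opt) = - c * H" by (simp only: Ex_cmult Hm_def)
  have "Ex m R (\<lambda>r. (g r + - (1 / (m - 1)) * T R v_opt r + (Ex m R (T R v_opt) / (m - 1) - 1))\<^sup>2)
      = Ex m R (\<lambda>r. (g r - g_opt r)\<^sup>2)"
  proof (rule Ex_cong_AE)
    show "AE r in lebesgue_on {0<..<R}. (g r + - (1 / (m - 1)) * T R v_opt r
        + (Ex m R (T R v_opt) / (m - 1) - 1))\<^sup>2 = (g r - g_opt r)\<^sup>2"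
      using v_opt(2)
    proof eventually_elim
      case (elim r)
      have "- (1 / (m - 1)) * (- c * T R z r) + (- c * H / (m - 1) - 1) = - g_opt r"
      proof -
        define n N where "n = m - 1" and "N = m - H"
        have n: "n \<noteq> 0" "N \<noteq> 0" and c: "c = n / N" and mN: "m = N + H"
          using m H_less by (auto simp: n_def N_def cm_def)
        have "- (1 / n) * (- c * T R z r) + (- c * H / n - 1) = - ((N + H - T R z r) / N)"
          unfolding c using n by (simp add: field_simps)
        then show ?thesis
          unfolding g_opt_def n_def[symmetric] N_def[symmetric] using mN by simp
      qed
      then show ?case unfolding elim E by (metis add.assoc diff_conv_add_uminus)
    qed
    show "(\<lambda>r. (g r + - (1 / (m - 1)) * T R v_opt r + (Ex m R (T R v_opt) / (m - 1) - 1))\<^sup>2)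
        \<in> borel_measurable (lebesgue_on {0<..<R})"
      by (intro borel_measurable_power L2w_measurable L2w_intros g tL)
    show "(\<lambda>r. (g r - g_opt r)\<^sup>2) \<in> borel_measurable (lebesgue_on {0<..<R})"
      by (intro borel_measurable_power L2w_measurable L2w_intros g g_opt)
  qed
  then show ?thesis using J_minus_Phi[OF v_opt(1) g] by simp
qed

lemma J_v_opt: "J m R v_opt = 1 - c"
proof -
  note zL = H1w_D[OF z_H1w] and vL = H1w_D[OF v_opt(1)] and tL = T_L2w[OF v_opt(1)] and sL = T_L2w[OF z_H1w]
  have 0: "Ex m R (\<lambda>r. (f r + c * h r)\<^sup>2) = 0"
    if "AE r in lebesgue_on {0<..<R}. f r = - c * h r" for f h
  proof -
    have "AE r in mu m R. (f r + c * h r)\<^sup>2 = 0"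
      unfolding AE_mu_iff using that by eventually_elim simp
    then show ?thesis unfolding Ex_def by (rule integral_eq_zero_AE)
  qed
  have "Phi m R g_opt v_opt = 1 - c"
    unfolding Phi_g_opt[OF v_opt(1)] by (simp add: 0[OF v_opt(2)] 0[OF v_opt(3)] v_opt_def Ex_const[of 0, simplified])
  then show ?thesis using Phi_v_opt[OF g_opt] Ex_const[of 0] by simp
qed

text \<open>Sandwiching \<open>\<Phi>(g_opt, v)\<close> transfers its minimum to \<open>J\<close>; the square kept in the first bound
  makes the minimizer of \<open>J\<close> unique.\<close>

lemma J_lower_bound:
  assumes v: "v \<in> H1w m R"
  shows "1 - c + Ex m R (\<lambda>r. (v r + c * z r)\<^sup>2) \<le> Phi m R g_opt v" "Phi m R g_opt v \<le> J m R v"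
proof -
  have "0 \<le> Ex m R (\<lambda>r. (T R v r + c * T R z r)\<^sup>2) / m"
    using m by (intro divide_nonneg_pos Ex_square_nonneg) auto
  then show "1 - c + Ex m R (\<lambda>r. (v r + c * z r)\<^sup>2) \<le> Phi m R g_opt v"
    unfolding Phi_g_opt[OF v] using Ex_square_nonneg[of "\<lambda>r. wd R v r + c * wd R z r"] by linarith
  have "0 \<le> J m R v - Phi m R g_opt v"
    unfolding J_minus_Phi[OF v g_opt] using m by (intro mult_nonneg_nonneg Ex_square_nonneg) auto
  then show "Phi m R g_opt v \<le> J m R v" by simp
qed

lemma J_ge: "v \<in> H1w m R \<Longrightarrow> 1 - c \<le> J m R v"
  using J_lower_bound[of v] Ex_square_nonneg[of "\<lambda>r. v r + c * z r"] by linarith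

lemma is_minimizer_v_opt: "is_minimizer m R v_opt"
  using v_opt(1) J_ge by (simp add: is_minimizer_def J_v_opt)

lemma minimizer_unique:
  assumes u: "is_minimizer m R u"
  shows "AE r in lebesgue_on {0<..<R}. u r = v_opt r"
proof -
  have uH: "u \<in> H1w m R" and "J m R u \<le> 1 - c"
    using u v_opt(1) J_v_opt by (auto simp: is_minimizer_def)
  then have "Ex m R (\<lambda>r. (u r + c * z r)\<^sup>2) = 0"
    using J_lower_bound[OF uH] Ex_square_nonneg[of "\<lambda>r. u r + c * z r"] by linarith
  then have "AE r in lebesgue_on {0<..<R}. u r + c * z r = 0"
    by (intro Ex_square_eq_0_imp L2w_intros H1w_D uH z_H1w)
  then show ?thesis by eventually_elim (simp add: v_opt_def)
qed

lemma INF_J: "(INF v\<in>H1w m R. ereal (J m R v)) = ereal (1 - c)"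
proof (rule antisym)
  show "(INF v\<in>H1w m R. ereal (J m R v)) \<le> ereal (1 - c)"
    using INF_lower[OF v_opt(1), of "\<lambda>v. ereal (J m R v)"] by (simp add: J_v_opt)
  show "ereal (1 - c) \<le> (INF v\<in>H1w m R. ereal (J m R v))"
    by (rule INF_greatest) (simp add: J_ge)
qed

lemma inner_inf_le:
  assumes g: "g \<in> L2w m R" "Ex m R g = 1"
  shows "inner_inf m R g \<le> ereal (1 - c - (m - 1) / m * Ex m R (\<lambda>r. (g r - g_opt r)\<^sup>2))"
  using INF_lower[OF v_opt(1), of "\<lambda>v. ereal (Phi m R g v)"]
  by (simp add: inner_inf_def Phi_v_opt[OF g] J_v_opt)

lemma inner_inf_g_opt: "inner_inf m R g_opt = ereal (1 - c)"
proof (rule antisym)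
  show "inner_inf m R g_opt \<le> ereal (1 - c)"
    using inner_inf_le[OF g_opt] Ex_const[of 0] by simp
  show "ereal (1 - c) \<le> inner_inf m R g_opt"
    unfolding inner_inf_def
  proof (rule INF_greatest)
    fix v assume "v \<in> H1w m R"
    then show "ereal (1 - c) \<le> ereal (Phi m R g_opt v)"
      using J_lower_bound(1)[of v] Ex_square_nonneg[of "\<lambda>r. v r + c * z r"] by simp
  qed
qed

lemma lambda_eq: "lambda m R = ereal (1 - c)"
proof (rule antisym)
  show "lambda m R \<le> ereal (1 - c)"
    unfolding lambda_def
  proof (rule SUP_least)
    fix g assume "g \<in> {g \<in> L2w m R. Ex m R g = 1}"
    then have g: "g \<in> L2w m R" "Ex m R g = 1" by auto
    have "0 \<le> (m - 1) / m * Ex m R (\<lambda>r. (g r - g_opt r)\<^sup>2)"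
      using m by (intro mult_nonneg_nonneg Ex_square_nonneg) auto
    then show "inner_inf m R g \<le> ereal (1 - c)"
      by (intro order_trans[OF inner_inf_le[OF g]]) simp
  qed
  show "ereal (1 - c) \<le> lambda m R"
    unfolding lambda_def inner_inf_g_opt[symmetric]
    by (rule SUP_upper) (use g_opt in simp)
qed

lemma attains_sup_g_opt: "attains_sup m R g_opt"
  by (simp add: attains_sup_def g_opt inner_inf_g_opt lambda_eq)

lemma attains_sup_unique:
  assumes "attains_sup m R g"
  shows "AE r in lebesgue_on {0<..<R}. g r = g_opt r"
proof -
  have g: "g \<in> L2w m R" "Ex m R g = 1" and "inner_inf m R g = ereal (1 - c)"
    using assms by (auto simp: attains_sup_def lambda_eq)
  then have "(m - 1) / m * Ex m R (\<lambda>r. (g r - g_opt r)\<^sup>2) \<le> 0"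
    using inner_inf_le[OF g] by simp
  moreover have "0 < (m - 1) / m" using m by simp
  ultimately have "Ex m R (\<lambda>r. (g r - g_opt r)\<^sup>2) \<le> 0" by (meson mult_pos_pos not_less)
  then have "Ex m R (\<lambda>r. (g r - g_opt r)\<^sup>2) = 0"
    using Ex_square_nonneg[of "\<lambda>r. g r - g_opt r"] by linarith
  then have "AE r in lebesgue_on {0<..<R}. g r - g_opt r = 0"
    by (intro Ex_square_eq_0_imp L2w_intros g g_opt)
  then show ?thesis by eventually_elim simp
qed

lemma T_eq_AE: "AE r in lebesgue_on {0<..<R}. T R z r = r * z r - deriv z r"
proof -
  obtain z' where "regular_solution 1 z z'" and ae: "AE r in lebesgue_on {0<..<R}. wd R z r = z' r"
    and d: "\<And>r. r \<in> {0<..<R} \<Longrightarrow> deriv z r = z' r"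
    using bvp_solution_regular[OF z] by blast
  from ae show ?thesis
    by (rule AE_mp) (auto intro!: AE_I2 simp: T_def d)
qed

end

theorem lemma5p2:
  fixes m R :: real
  assumes "m > 1" and "R > 0"
  shows "lambda m R = (INF v\<in>H1w m R. ereal (J m R v)) \<and>
    (\<exists>v. is_minimizer m R v \<and>
         (\<forall>u. is_minimizer m R u \<longrightarrow> (AE r in lebesgue_on {0<..<R}. u r = v r))) \<and>
    (\<exists>z. bvp_solution m R z \<and>
         (\<forall>y. bvp_solution m R y \<longrightarrow> (\<forall>r\<in>{0<..R}. y r = z r))) \<and>
    (\<forall>z. bvp_solution m R z \<longrightarrow>
       m - Hm m R z \<noteq> 0 \<and>
       is_minimizer m R (\<lambda>r. - cm m R z * z r) \<and>
       lambda m R = ereal (1 - cm m R z) \<and>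
       1 - cm m R z = (1 - Hm m R z) / (m - Hm m R z) \<and>
       attains_sup m R (\<lambda>r. (m - T R z r) / (m - Hm m R z)) \<and>
       (\<forall>g. attains_sup m R g \<longrightarrow>
          (AE r in lebesgue_on {0<..<R}. g r = (m - T R z r) / (m - Hm m R z))) \<and>
       (AE r in lebesgue_on {0<..<R}.
          (m - T R z r) / (m - Hm m R z) = (m - r * z r + deriv z r) / (m - Hm m R z)))"
proof -
  interpret gaussian_interval m R by unfold_locales (rule assms)+
  obtain z\<^sub>0 where z\<^sub>0: "bvp_solution m R z\<^sub>0"
    using bvp_solution_exists by blast
  interpret z\<^sub>0: gaussian_bvp m R z\<^sub>0 by unfold_locales (rule z\<^sub>0)
  show ?thesis
  proof (intro conjI allI impI)
    show "lambda m R = (INF v\<in>H1w m R. ereal (J m R v))"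
      by (simp add: z\<^sub>0.lambda_eq z\<^sub>0.INF_J)
    show "\<exists>v. is_minimizer m R v \<and>
        (\<forall>u. is_minimizer m R u \<longrightarrow> (AE r in lebesgue_on {0<..<R}. u r = v r))"
      using z\<^sub>0.is_minimizer_v_opt z\<^sub>0.minimizer_unique by blast
    show "\<exists>z. bvp_solution m R z \<and> (\<forall>y. bvp_solution m R y \<longrightarrow> (\<forall>r\<in>{0<..R}. y r = z r))"
      using z\<^sub>0 bvp_solution_unique by blast
  next
    fix z assume z: "bvp_solution m R z"
    interpret gaussian_bvp m R z by unfold_locales (rule z)
    show "m - Hm m R z \<noteq> 0" using H_less by simp
    show "is_minimizer m R (\<lambda>r. - cm m R z * z r)"
      using is_minimizer_v_opt by (simp add: v_opt_def[abs_def])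
    show "lambda m R = ereal (1 - cm m R z)" by (rule lambda_eq)
    show "1 - cm m R z = (1 - Hm m R z) / (m - Hm m R z)"
      using H_less by (simp add: cm_def field_simps)
    show "attains_sup m R (\<lambda>r. (m - T R z r) / (m - Hm m R z))"
      using attains_sup_g_opt by (simp add: g_opt_def[abs_def])
    show "AE r in lebesgue_on {0<..<R}. g r = (m - T R z r) / (m - Hm m R z)"
      if "attains_sup m R g" for g
      using attains_sup_unique[OF that] by (simp add: g_opt_def)
    show "AE r in lebesgue_on {0<..<R}.
        (m - T R z r) / (m - Hm m R z) = (m - r * z r + deriv z r) / (m - Hm m R z)"
      using T_eq_AE by eventually_elim simp
  qed
qed

end
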